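(* Let $(\mathsf{Z},\mathsf{X},\Xi,g,f,\nu,\eta,M_z)$ be as in the context. Assume the following. (1) There exist $\varepsilon\in(0,1)$ and a probability measure $\kappa$ on $(\mathsf{X},\mathscr{X})$ such that for every $(z,x)\in\mathsf{Z}\times\mathsf{X}$, $$M_z(x,dx')\ge \varepsilon\,\kappa(dx').$$ (2) For every $(i,j)\in\{1,\dots,k\}^2$, $$\sup_{(z,x,\xi)\in\mathsf{Z}\times\mathsf{X}\times\Xi}|g(z,x,\xi)^{(i)}|<+\infty,\qquad \sup_{(z,u)\in\mathsf{Z}\times\mathbb{R}^k}|\nabla f(z,u)^{(i)}|<+\infty,\qquad \sup_{(z,x,\xi)\in\mathsf{Z}\times\mathsf{X}\times\Xi}|\nabla g(z,x,\xi)^{(i,j)}|<+\infty.$$ (3) There exists $C<\infty$ such that for every $i\in\{1,\dots,k\}$, $z,z'\in\mathsf{Z}$ and $u,u'\in\mathbb{R}^k$, $$|\nabla f(z,u)^{(i)}-\nabla f(z,u')^{(i)}|\le C\left(\|z-z'\|+\|u-u'\|\right).$$ Let $\beta\in(0,1)$ be arbitrary and let $\mathbb{P}_L$ be the probability mass function on $\mathbb{N}=\{1,2,\dots\}$ with $\mathbb{P}_L(l)\propto 2^{-\beta l}$. Let $\widehat{H}(z,\xi)$ be the randomized estimator defined in the context using this $\mathbb{P}_L$. Then for every $(i,z,\xi)\in\{1,\dots,k\}\times\mathsf{Z}\times\Xi$, $$\mathbb{E}[\widehat{H}(z,\xi)]=H(z,\xi)\qquad\text{and}\qquad \mathbb{E}\left[\left(\widehat{H}(z,\xi)^{(i)}\right)^2\right]<+\infty,$$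 where $\mathbb{E}$ denotes expectation with respect to the law used to generate $\widehat{H}(z,\xi)$ (with $z$ and $\xi$ fixed).
   Context: Setting. $\mathsf{Z}$ is a measurable subset of a Euclidean space, $(\mathsf{X},\mathscr{X})$ is a measurable space with a dominating measure $dx$, and $\Xi\subseteq\mathbb{R}^k$. The functions $g:\mathsf{Z}\times\mathsf{X}\times\Xi\to\mathbb{R}^k$ and $f:\mathsf{Z}\times\mathbb{R}^k\to\mathbb{R}$ are appropriately measurable, and differentiable in the arguments indicated next. $\nabla g(z,x,\xi)$ is the $k\times k$ Jacobian of $g$ with respect to $\xi$, and $\nabla f(z,u)\in\mathbb{R}^k$ is the gradient of $f$ with respect to its second argument $u$. A superscript $(i)$ denotes the $i$-th component of a vector and $(i,j)$ the $(i,j)$ entry of a matrix. $\|\cdot\|$ is the $L_2$ (Euclidean) norm. $(Z,X)$ is a pair of random variables in $\mathsf{Z}\times\mathsf{X}$ with joint density $\pi(z)\nu(x|z)$ with respect to a dominating measure $dx\otimes dz$; thus, for each $z\in\mathsf{Z}$, $\nu(x|z)dx$ is the conditional law of $X$ given $Z=z$. The target quantity is $$H(z,\xi)=\mathbb{E}[\nabla g(Z,X,\xi)|Z=z]^{\top}\nabla f\left(z,\mathbb{E}[g(Z,X,\xi)|Z=z]\right)\in\mathbb{R}^k.$$ For each $z\in\mathsf{Z}$, $\eta(x|z)dx$ is a probability measure on $(\mathsf{X},\mathscr{X})$ with $\eta$ strictly positive, and $M_z:\mathsf{X}\times\mathscr{X}\to[0,1]$ is an ergodic Markov kernel that admits $\nu(x|z)dx$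 as its stationary measure. Procedure MC with $N$ samples ($N\in\mathbb{N}$): sample $X_0\sim\eta(\cdot|z)$, then $X_n|X_{n-1}=x_{n-1}\sim M_z(x_{n-1},\cdot)$ for $n=1,\dots,N$, and return the empirical measure $\nu_z^N=\frac{1}{N+1}\sum_{n=0}^N\delta_{X_n}$, so that $\nu_z^N(\alpha)=\frac{1}{N+1}\sum_{n=0}^N\alpha(X_n)$ (applied entrywise for vector- or matrix-valued $\alpha$). Estimator. Let $N_0=0$ and $N_l=2^l$ for $l\in\mathbb{N}=\{1,2,\dots\}$, and let $\mathbb{P}_L$ be a positive probability mass function on $\mathbb{N}$. Fix $z\in\mathsf{Z}$ and $\xi\in\Xi$. Sample $L\sim\mathbb{P}_L$. If $L=1$, run MC with $N_1$ samples and set $$\widehat{H}(z,\xi)=\frac{1}{\mathbb{P}_L(L)}\,\nu_z^{N_1}(\nabla g(z,\cdot,\xi))^{\top}\nabla f\left(z,\nu_z^{N_1}(g(z,\cdot,\xi))\right).$$ If $L\ge 2$, for $p\in\{1,\dots,L\}$ independently run MC with $N_p-N_{p-1}$ samples, giving empirical measures $\nu_z^{N_p-N_{p-1}}$. For $l\in\{1,\dots,L\}$ set $$\nu_z^{N_{1:l}}(\alpha)=\sum_{p=1}^l\left(\frac{N_p-N_{p-1}+1}{N_l}\right)\nu_z^{N_p-N_{p-1}}(\alpha).$$ Then, using the same runs in both terms, set $$\widehat{H}(z,\xi)=\frac{1}{\mathbb{P}_L(L)}\left\{\nu_z^{N_{1:L}}(\nabla g(z,\cdot,\xi))^{\top}\nabla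 f\left(z,\nu_z^{N_{1:L}}(g(z,\cdot,\xi))\right)-\nu_z^{N_{1:L-1}}(\nabla g(z,\cdot,\xi))^{\top}\nabla f\left(z,\nu_z^{N_{1:L-1}}(g(z,\cdot,\xi))\right)\right\}.$$
   Formalization: The weights in ν_z^{N_{1:l}} use denominator N_l + l (the total number of points in runs 1..l) instead of the printed N_l; with N_l the estimator is biased, e.g. for one-point X, k=1, g=ξ on (-1,1), f(u)=u it has mean 1/2 while H=1. *)

theory Defs
  imports "HOL-Probability.Probability"
begin

section \<open>Markov chains\<close>

primrec kernel_pow :: "'x measure \<Rightarrow> ('x \<Rightarrow> 'x measure) \<Rightarrow> nat \<Rightarrow> 'x \<Rightarrow> 'x measure" where
  "kernel_pow S K 0 = return S"
| "kernel_pow S K (Suc n) = (\<lambda>x. kernel_pow S K n x \<bind> K)"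

text \<open>Ergodicity in the usual sense of Markov chain Monte Carlo: from every starting point the
  \<open>n\<close>-step law converges in total variation to \<open>\<mu>\<close>.\<close>

definition ergodic_kernel :: "'x measure \<Rightarrow> ('x \<Rightarrow> 'x measure) \<Rightarrow> 'x measure \<Rightarrow> bool" where
  "ergodic_kernel S K \<mu> \<longleftrightarrow>
     (\<forall>x\<in>space S. (\<lambda>n. SUP A\<in>sets S. \<bar>measure (kernel_pow S K n x) A - measure \<mu> A\<bar>) \<longlonglongrightarrow> 0)"

definition stationary_measure :: "('x \<Rightarrow> 'x measure) \<Rightarrow> 'x measure \<Rightarrow> bool" where
  "stationary_measure K \<mu> \<longleftrightarrow> \<mu> \<bind> K = \<mu>"

text \<open>Joint law of \<open>(X\<^sub>0, \<dots>, X\<^sub>n)\<close>, with \<open>X\<^sub>0 \<sim> \<mu>\<close> and transitions \<open>K\<close>, as a measure on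
  \<open>PiM {..n} (\<lambda>_. S)\<close>.\<close>

primrec chain_law :: "'x measure \<Rightarrow> 'x measure \<Rightarrow> ('x \<Rightarrow> 'x measure) \<Rightarrow> nat \<Rightarrow> (nat \<Rightarrow> 'x) measure" where
  "chain_law S \<mu> K 0 = distr \<mu> (PiM {..0} (\<lambda>_. S)) (\<lambda>x. \<lambda>i\<in>{..0}. x)"
| "chain_law S \<mu> K (Suc n) =
     chain_law S \<mu> K n \<bind>
       (\<lambda>\<omega>. distr (K (\<omega> n)) (PiM {..Suc n} (\<lambda>_. S)) (\<lambda>x. fun_upd \<omega> (Suc n) x))"

definition empirical_mean :: "nat \<Rightarrow> (nat \<Rightarrow> 'x) \<Rightarrow> ('x \<Rightarrow> 'b::real_vector) \<Rightarrow> 'b" where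
  "empirical_mean n x \<alpha> = (1 / real (n + 1)) *\<^sub>R (\<Sum>i\<le>n. \<alpha> (x i))"


section \<open>The target quantity\<close>

text \<open>\<open>D\<^sup>T \<nabla>f(v)\<close>\<close>

definition plug_in :: "(real^'k \<Rightarrow> real^'k) \<Rightarrow> real^'k^'k \<Rightarrow> real^'k \<Rightarrow> real^'k" where
  "plug_in df D v = transpose D *v df v"

text \<open>\<open>H(z,\<xi>)\<close>. The conditional law of \<open>X\<close> given \<open>Z = z\<close> is \<open>\<nu>(x|z)dx\<close>, so
  \<open>E[\<alpha>(Z,X) | Z = z]\<close> is the integral of \<open>\<alpha>(z,\<cdot>)\<close> against \<open>density dX (\<nu> z)\<close>.\<close>

definition H_target ::
  "'x measure \<Rightarrow> ('z \<Rightarrow> 'x \<Rightarrow> real) \<Rightarrow> ('z \<Rightarrow> 'x \<Rightarrow> real^'k \<Rightarrow> real^'k) \<Rightarrow>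
   ('z \<Rightarrow> 'x \<Rightarrow> real^'k \<Rightarrow> real^'k^'k) \<Rightarrow> ('z \<Rightarrow> real^'k \<Rightarrow> real^'k) \<Rightarrow>
   'z \<Rightarrow> real^'k \<Rightarrow> real^'k" where
  "H_target dX \<nu> g Dg Df z \<xi> =
     plug_in (Df z) (\<integral>x. Dg z x \<xi> \<partial>density dX (\<nu> z)) (\<integral>x. g z x \<xi> \<partial>density dX (\<nu> z))"


section \<open>The randomized estimator\<close>

definition level_size :: "nat \<Rightarrow> nat" where
  "level_size l = (if l = 0 then 0 else 2 ^ l)"

definition run_length :: "nat \<Rightarrow> nat" where
  "run_length p = level_size p - level_size (p - 1)"

text \<open>The pooled empirical measure \<open>\<nu>\<^sub>z\<^bsup>N\<^sub>1\<^sub>:\<^sub>l\<^esup>\<close> of runs \<open>1, \<dots>, l\<close>, where \<open>\<omega> p\<close> is the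
  trajectory of run \<open>p\<close>. Run \<open>p\<close> consists of \<open>N\<^sub>p - N\<^sub>p\<^sub>-\<^sub>1 + 1\<close> points (the initial draw included),
  hence there are \<open>N\<^sub>l + l\<close> points in total, and this is the normalizing constant used here.
  The
  source prints the weights with denominator \<open>N\<^sub>l\<close>. Their sum is then \<open>1 + l / N\<^sub>l\<close>, so at \<open>l = 1\<close>
  the pooled measure is \<open>3 / 2\<close> times the empirical measure used in the branch \<open>L = 1\<close>, the
  telescoping sum breaks, and the estimator is biased already for constant \<open>\<nabla>g\<close> and \<open>\<nabla>f\<close>.
  This is the only departure from the printed definition.\<close>

definition pooled_mean :: "nat \<Rightarrow> (nat \<Rightarrow> nat \<Rightarrow> 'x) \<Rightarrow> ('x \<Rightarrow> 'b::real_vector) \<Rightarrow> 'b" where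
  "pooled_mean l \<omega> \<alpha> =
     (\<Sum>p=1..l. (real (run_length p + 1) / real (level_size l + l)) *\<^sub>R
        empirical_mean (run_length p) (\<omega> p) \<alpha>)"

definition H_hat ::
  "('z \<Rightarrow> 'x \<Rightarrow> real^'k \<Rightarrow> real^'k) \<Rightarrow> ('z \<Rightarrow> 'x \<Rightarrow> real^'k \<Rightarrow> real^'k^'k) \<Rightarrow>
   ('z \<Rightarrow> real^'k \<Rightarrow> real^'k) \<Rightarrow> nat pmf \<Rightarrow> 'z \<Rightarrow> real^'k \<Rightarrow>
   nat \<Rightarrow> (nat \<Rightarrow> nat \<Rightarrow> 'x) \<Rightarrow> real^'k" where
  "H_hat g Dg Df PL z \<xi> L \<omega> =
     (1 / pmf PL L) *\<^sub>R
       (if L = 1 then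
          plug_in (Df z) (empirical_mean (level_size 1) (\<omega> 1) (\<lambda>x. Dg z x \<xi>))
                         (empirical_mean (level_size 1) (\<omega> 1) (\<lambda>x. g z x \<xi>))
        else
          plug_in (Df z) (pooled_mean L \<omega> (\<lambda>x. Dg z x \<xi>)) (pooled_mean L \<omega> (\<lambda>x. g z x \<xi>))
          - plug_in (Df z) (pooled_mean (L - 1) \<omega> (\<lambda>x. Dg z x \<xi>))
                           (pooled_mean (L - 1) \<omega> (\<lambda>x. g z x \<xi>)))"

text \<open>Given \<open>L = l\<close>, the runs \<open>1, \<dots>, l\<close> are independent.\<close>

definition runs_law ::
  "'x measure \<Rightarrow> 'x measure \<Rightarrow> ('x \<Rightarrow> 'x measure) \<Rightarrow> nat \<Rightarrow> (nat \<Rightarrow> nat \<Rightarrow> 'x) measure" where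
  "runs_law S \<mu> K l = PiM {1..l} (\<lambda>p. chain_law S \<mu> K (run_length p))"

text \<open>The law on \<open>\<real>\<^sup>k\<close> of the estimator at \<open>(z,\<xi>)\<close>.\<close>

definition H_hat_law ::
  "'x measure \<Rightarrow> ('z \<Rightarrow> 'x \<Rightarrow> real) \<Rightarrow> ('z \<Rightarrow> 'x \<Rightarrow> 'x measure) \<Rightarrow>
   ('z \<Rightarrow> 'x \<Rightarrow> real^'k \<Rightarrow> real^'k) \<Rightarrow> ('z \<Rightarrow> 'x \<Rightarrow> real^'k \<Rightarrow> real^'k^'k) \<Rightarrow>
   ('z \<Rightarrow> real^'k \<Rightarrow> real^'k) \<Rightarrow> nat pmf \<Rightarrow> 'z \<Rightarrow> real^'k \<Rightarrow> (real^'k) measure" where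
  "H_hat_law dX \<eta> M g Dg Df PL z \<xi> =
     measure_pmf PL \<bind>
       (\<lambda>l. distr (runs_law dX (density dX (\<eta> z)) (M z) l) borel (H_hat g Dg Df PL z \<xi> l))"

end

(*
The minorization makes K contract oscillations by 1 - \<epsilon>, so for bounded u the Poisson equation
h - K h = u - \<pi>(u) is solved by a bounded Neumann series. Rewriting the centred partial sums of the
chain through h gives a second moment of order n after n steps, from any initial law. The length of
run p is of order 2^p, so these bounds add up geometrically (without using the independence of the
runs) and the pooled mean at level l has mean squared error O(2^-l). Since \<nabla>f is bounded and
Lipschitz, the plug-in value at level l is within O(2^-l) of H in mean square. Hence the level
differences telescope in expectation to H, and the second moment of the estimator is of order
sum_l 2^(\<beta> l) 2^-l, finite because \<beta> < 1.
*)

theory Submission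
  imports Defs
begin

text \<open>The weight \<open>1 / pmf PL L\<close> makes the estimator unbounded in general, so
  nothing about its law can be read off from boundedness. The second moment therefore comes before
  the mean: nonnegative integrals pass through the mixture over the level freely, a finite second
  moment gives integrability, and only then may the mean be computed level by level. The Poisson
  equation is chosen because a run starts from \<eta> and not from its stationary law: expanding the
  square of a partial sum would bring in covariances and squared biases, whereas one recursion for a
  corrected sum handles both. The bias is also why independence of the runs would not remove the
  cross terms of the pooled sum. Since the second moments of the runs grow geometrically, a weighted
  Young inequality absorbs the cross terms into the constant. The two terms of a level difference
  are compared with H separately. This is sharp enough, since each squared error is already of order
  2^-l, so a Lipschitz gradient suffices.\<close>

section \<open>Integrals of real functions against a mixture of measures\<close>

text \<open>Tonelli for the positive and the negative part, for an \<open>f\<close> that need not be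
  bounded. Integrability is assumed only under the mixture; under the single \<open>N x\<close> it
  then follows for almost every \<open>x\<close>.\<close>

lemma
  fixes f :: "'b \<Rightarrow> real"
  assumes N [measurable]: "N \<in> M \<rightarrow>\<^sub>M subprob_algebra K"
    and sets: "sets (M \<bind> N) = sets K"
    and f: "integrable (M \<bind> N) f"
  shows integrable_integral_bind: "integrable M (\<lambda>x. \<integral>y. f y \<partial>N x)"
    and integral_bind_integrable: "(\<integral>y. f y \<partial>(M \<bind> N)) = (\<integral>x. \<integral>y. f y \<partial>N x \<partial>M)"
proof -
  have f_meas: "f \<in> borel_measurable (M \<bind> N)"
    using f by (rule borel_measurable_integrable)
  have [measurable]: "f \<in> borel_measurable K"
    using f_meas measurable_cong_sets[OF sets refl] by blast
  have nonneg: "integrable M (\<lambda>x. \<integral>y. u y \<partial>N x) \<and>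
      (\<integral>y. u y \<partial>(M \<bind> N)) = (\<integral>x. \<integral>y. u y \<partial>N x \<partial>M) \<and> (AE x in M. integrable (N x) u)"
    if u: "integrable (M \<bind> N) u" "\<And>y. 0 \<le> u y" and [measurable]: "u \<in> borel_measurable K"
    for u :: "'b \<Rightarrow> real"
  proof -
    have eq: "(\<integral>\<^sup>+y. u y \<partial>(M \<bind> N)) = (\<integral>\<^sup>+x. \<integral>\<^sup>+y. u y \<partial>N x \<partial>M)"
      by (rule nn_integral_bind[of _ K]) measurable
    have fin: "(\<integral>\<^sup>+y. u y \<partial>(M \<bind> N)) = ennreal (\<integral>y. u y \<partial>(M \<bind> N))"
      using u by (intro nn_integral_eq_integral) auto
    have "(\<integral>\<^sup>+x. \<integral>\<^sup>+y. u y \<partial>N x \<partial>M) \<noteq> \<infinity>"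
      unfolding eq[symmetric] fin by simp
    moreover have "(\<lambda>x. \<integral>\<^sup>+y. u y \<partial>N x) \<in> borel_measurable M"
      by measurable
    ultimately have "AE x in M. (\<integral>\<^sup>+y. u y \<partial>N x) \<noteq> \<infinity>"
      by (intro nn_integral_PInf_AE) auto
    then have ae: "AE x in M. integrable (N x) u"
    proof (rule AE_mp, intro AE_I2 impI)
      fix x assume "x \<in> space M" "(\<integral>\<^sup>+y. u y \<partial>N x) \<noteq> \<infinity>"
      then show "integrable (N x) u"
        using u(2) measurable_cong_sets[OF subprob_measurableD(2)[OF N, of x] refl]
        by (intro integrableI_nonneg) (auto simp: less_top)
    qed
    have "(\<integral>\<^sup>+x. \<integral>\<^sup>+y. u y \<partial>N x \<partial>M) = (\<integral>\<^sup>+x. ennreal (\<integral>y. u y \<partial>N x) \<partial>M)"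
      using ae by (intro nn_integral_cong_AE, eventually_elim)
        (use u(2) in \<open>auto intro!: nn_integral_eq_integral\<close>)
    with eq fin have *: "(\<integral>\<^sup>+x. ennreal (\<integral>y. u y \<partial>N x) \<partial>M) = ennreal (\<integral>y. u y \<partial>(M \<bind> N))"
      by simp
    have "integrable M (\<lambda>x. \<integral>y. u y \<partial>N x) \<and>
        (\<integral>x. \<integral>y. u y \<partial>N x \<partial>M) = (\<integral>y. u y \<partial>(M \<bind> N))"
      using * by (subst (asm) nn_integral_eq_integrable) (use u(2) in auto)
    with ae show ?thesis by simp
  qed
  let ?p = "\<lambda>y. max 0 (f y)" and ?n = "\<lambda>y. max 0 (- f y)"
  have pn: "f y = ?p y - ?n y" for y by auto
  have ip: "integrable (M \<bind> N) ?p" and i_n: "integrable (M \<bind> N) ?n"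
    using f by auto
  have P: "integrable M (\<lambda>x. \<integral>y. ?p y \<partial>N x) \<and>
      (\<integral>y. ?p y \<partial>(M \<bind> N)) = (\<integral>x. \<integral>y. ?p y \<partial>N x \<partial>M) \<and> (AE x in M. integrable (N x) ?p)"
    by (rule nonneg[OF ip]) auto
  have Q: "integrable M (\<lambda>x. \<integral>y. ?n y \<partial>N x) \<and>
      (\<integral>y. ?n y \<partial>(M \<bind> N)) = (\<integral>x. \<integral>y. ?n y \<partial>N x \<partial>M) \<and> (AE x in M. integrable (N x) ?n)"
    by (rule nonneg[OF i_n]) auto
  have "AE x in M. integrable (N x) ?p" "AE x in M. integrable (N x) ?n"
    using P Q by auto
  \<comment> \<open>Where a part fails to be integrable, its Bochner integral takes the default
    value 0 and this splitting may be false; such \<open>x\<close> form a null set.\<close>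
  then have ae: "AE x in M. (\<integral>y. f y \<partial>N x) = (\<integral>y. ?p y \<partial>N x) - (\<integral>y. ?n y \<partial>N x)"
  proof eventually_elim
    case (elim x)
    have "(\<integral>y. f y \<partial>N x) = (\<integral>y. ?p y - ?n y \<partial>N x)" by (simp only: pn[symmetric])
    with elim show ?case by (simp only: Bochner_Integration.integral_diff)
  qed
  have meas: "(\<lambda>x. \<integral>y. f y \<partial>N x) \<in> borel_measurable M" by measurable
  have idiff: "integrable M (\<lambda>x. (\<integral>y. ?p y \<partial>N x) - (\<integral>y. ?n y \<partial>N x))"
    using P Q by simp
  then show "integrable M (\<lambda>x. \<integral>y. f y \<partial>N x)"
    using integrable_cong_AE[OF meas borel_measurable_integrable[OF idiff] ae] by simp
  have "(\<integral>x. \<integral>y. f y \<partial>N x \<partial>M) = (\<integral>x. (\<integral>y. ?p y \<partial>N x) - (\<integral>y. ?n y \<partial>N x) \<partial>M)"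
    by (rule integral_cong_AE[OF meas borel_measurable_integrable[OF idiff] ae])
  also have "\<dots> = (\<integral>x. \<integral>y. ?p y \<partial>N x \<partial>M) - (\<integral>x. \<integral>y. ?n y \<partial>N x \<partial>M)"
    using P Q by (intro Bochner_Integration.integral_diff) auto
  also have "\<dots> = (\<integral>y. ?p y \<partial>(M \<bind> N)) - (\<integral>y. ?n y \<partial>(M \<bind> N))"
    using P Q by simp
  also have "\<dots> = (\<integral>y. ?p y - ?n y \<partial>(M \<bind> N))"
    using ip i_n by (intro Bochner_Integration.integral_diff[symmetric]) auto
  also have "\<dots> = (\<integral>y. f y \<partial>(M \<bind> N))"
    by (simp only: pn[symmetric])
  finally show "(\<integral>y. f y \<partial>(M \<bind> N)) = (\<integral>x. \<integral>y. f y \<partial>N x \<partial>M)" ..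
qed

section \<open>Minorized kernels and the Poisson equation\<close>

text \<open>The Markov operator of \<open>K\<close> acting on functions. Its iterates
  \<open>avg K ^^ n\<close> replace the \<open>n\<close>-step laws throughout the proof.\<close>

definition avg :: "('x \<Rightarrow> 'x measure) \<Rightarrow> ('x \<Rightarrow> real) \<Rightarrow> 'x \<Rightarrow> real" where
  "avg K u = (\<lambda>x. \<integral>y. u y \<partial>K x)"

text \<open>Doeblin's condition with the whole state space as a small set in one step, which makes
  every rate below uniform in the starting point.\<close>

locale minorized_kernel =
  fixes S :: "'x measure" and K :: "'x \<Rightarrow> 'x measure" and \<kappa> :: "'x measure" and \<epsilon> :: real
  assumes kernel [measurable]: "K \<in> S \<rightarrow>\<^sub>M prob_algebra S"
    and \<epsilon>_pos: "0 < \<epsilon>" and \<epsilon>_less_1: "\<epsilon> < 1"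
    and prob_\<kappa>: "prob_space \<kappa>" and sets_\<kappa>: "sets \<kappa> = sets S"
    and minorization:
      "\<And>x A. x \<in> space S \<Longrightarrow> A \<in> sets S \<Longrightarrow> \<epsilon> * measure \<kappa> A \<le> measure (K x) A"
begin

lemma kernel_subprob [measurable]: "K \<in> S \<rightarrow>\<^sub>M subprob_algebra S"
  by (rule measurable_prob_algebraD) measurable

lemma prob_space_kernel: "x \<in> space S \<Longrightarrow> prob_space (K x)"
  using measurable_space[OF kernel] by (auto simp: space_prob_algebra)

lemma sets_kernel_eq: "x \<in> space S \<Longrightarrow> sets (K x) = sets S"
  using measurable_space[OF kernel] by (auto simp: space_prob_algebra)

lemma space_kernel_eq: "x \<in> space S \<Longrightarrow> space (K x) = space S"
  by (intro sets_eq_imp_space_eq sets_kernel_eq)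

lemma measurable_kernel_space:
  "x \<in> space S \<Longrightarrow> u \<in> borel_measurable S \<Longrightarrow> u \<in> borel_measurable (K x)"
  using measurable_cong_sets[OF sets_kernel_eq refl] by blast

lemma measurable_\<kappa>: "u \<in> borel_measurable S \<Longrightarrow> u \<in> borel_measurable \<kappa>"
  using measurable_cong_sets[OF sets_\<kappa> refl] by blast

lemma measurable_avg [measurable]:
  "u \<in> borel_measurable S \<Longrightarrow> avg K u \<in> borel_measurable S"
  unfolding avg_def
  by (rule measurable_compose[OF kernel_subprob integral_measurable_subprob_algebra])

lemma integrable_kernel:
  fixes u :: "'x \<Rightarrow> real"
  assumes "u \<in> borel_measurable S" "\<And>y. y \<in> space S \<Longrightarrow> \<bar>u y\<bar> \<le> B" "x \<in> space S"
  shows "integrable (K x) u"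
proof -
  interpret prob_space "K x" using assms(3) by (rule prob_space_kernel)
  show ?thesis
    using assms space_kernel_eq[OF assms(3)]
    by (intro integrable_const_bound[where B=B] measurable_kernel_space) auto
qed

text \<open>The setwise minorization is an inequality between the measures
  \<open>scale_measure \<epsilon> \<kappa>\<close> and \<open>K x\<close>, so it passes to integrals
  of nonnegative functions. The upper bound \<open>B\<close> serves integrability.\<close>

lemma integral_minorization:
  fixes u :: "'x \<Rightarrow> real"
  assumes u [measurable]: "u \<in> borel_measurable S"
    and bd: "\<And>y. y \<in> space S \<Longrightarrow> 0 \<le> u y" "\<And>y. y \<in> space S \<Longrightarrow> u y \<le> B"
    and x: "x \<in> space S"
  shows "\<epsilon> * (\<integral>y. u y \<partial>\<kappa>) \<le> (\<integral>y. u y \<partial>K x)"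
proof -
  interpret \<kappa>: prob_space \<kappa> by (rule prob_\<kappa>)
  interpret Kx: prob_space "K x" using x by (rule prob_space_kernel)
  note [simp] = sets_\<kappa> sets_kernel_eq[OF x]
  have [simp]: "space \<kappa> = space S" by (intro sets_eq_imp_space_eq) simp
  have [simp]: "space (K x) = space S" by (rule space_kernel_eq[OF x])
  have [measurable]: "u \<in> borel_measurable \<kappa>" "u \<in> borel_measurable (K x)"
    using u x by (auto intro: measurable_kernel_space measurable_\<kappa>)
  have i\<kappa>: "integrable \<kappa> u"
    using bd by (intro \<kappa>.integrable_const_bound[where B=B]) auto
  have iK: "integrable (K x) u"
    using bd by (intro Kx.integrable_const_bound[where B=B]) auto
  have "scale_measure (ennreal \<epsilon>) \<kappa> \<le> K x"
  proof (subst le_measure)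
    show "\<forall>A\<in>sets (scale_measure (ennreal \<epsilon>) \<kappa>). emeasure (scale_measure (ennreal \<epsilon>) \<kappa>) A \<le> emeasure (K x) A"
      using minorization[OF x] \<epsilon>_pos
      by (auto simp: \<kappa>.emeasure_eq_measure Kx.emeasure_eq_measure ennreal_mult[symmetric])
  qed auto
  then have "(\<integral>\<^sup>+y. u y \<partial>scale_measure (ennreal \<epsilon>) \<kappa>) \<le> (\<integral>\<^sup>+y. u y \<partial>K x)"
    by (intro nn_integral_mono_measure) auto
  then have "ennreal \<epsilon> * (\<integral>\<^sup>+y. u y \<partial>\<kappa>) \<le> (\<integral>\<^sup>+y. u y \<partial>K x)"
    by (subst (asm) nn_integral_scale_measure) auto
  also have "(\<integral>\<^sup>+y. u y \<partial>\<kappa>) = ennreal (\<integral>y. u y \<partial>\<kappa>)"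
    using i\<kappa> bd by (intro nn_integral_eq_integral) auto
  also have "(\<integral>\<^sup>+y. u y \<partial>K x) = ennreal (\<integral>y. u y \<partial>K x)"
    using iK bd by (intro nn_integral_eq_integral) auto
  finally have "ennreal (\<epsilon> * (\<integral>y. u y \<partial>\<kappa>)) \<le> ennreal (\<integral>y. u y \<partial>K x)"
    using \<epsilon>_pos by (simp add: ennreal_mult')
  moreover have "0 \<le> (\<integral>y. u y \<partial>K x)"
    using bd by (intro integral_nonneg_AE) auto
  ultimately show ?thesis by (simp add: ennreal_le_iff)
qed

text \<open>Apply the minorization to the nonnegative functions \<open>u - a\<close> and
  \<open>b - u\<close>. This raises the lower endpoint by \<epsilon> times (k - a) and lowers the
  upper one by \<epsilon> times (b - k), where k is the \<kappa>-mean of \<open>u\<close>; k cancels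
  in the length. Oscillation is encoded as the length of an enclosing interval, whose endpoints may
  move.\<close>

lemma avg_contraction:
  assumes u [measurable]: "u \<in> borel_measurable S"
    and bd: "\<And>y. y \<in> space S \<Longrightarrow> u y \<in> {a..b}"
  obtains a' b' where "b' - a' = (1 - \<epsilon>) * (b - a)" "\<And>x. x \<in> space S \<Longrightarrow> avg K u x \<in> {a'..b'}"
proof
  interpret \<kappa>: prob_space \<kappa> by (rule prob_\<kappa>)
  let ?k = "\<integral>y. u y \<partial>\<kappa>"
  have i\<kappa>: "integrable \<kappa> u"
    using bd unfolding sets_eq_imp_space_eq[OF sets_\<kappa>, symmetric]
    by (intro \<kappa>.integrable_const_bound[where B="max \<bar>a\<bar> \<bar>b\<bar>"] measurable_\<kappa> u AE_I2) fastforce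
  show "(b - \<epsilon> * (b - ?k)) - (a + \<epsilon> * (?k - a)) = (1 - \<epsilon>) * (b - a)"
    by (simp add: algebra_simps)
  fix x assume x: "x \<in> space S"
  interpret Kx: prob_space "K x" using x by (rule prob_space_kernel)
  have iK: "integrable (K x) u"
    using bd x by (intro integrable_kernel[where B="max \<bar>a\<bar> \<bar>b\<bar>"]) fastforce+
  have "\<epsilon> * (\<integral>y. u y - a \<partial>\<kappa>) \<le> (\<integral>y. u y - a \<partial>K x)"
    using bd x by (intro integral_minorization[where B="b - a"]) auto
  then have 1: "\<epsilon> * (?k - a) \<le> avg K u x - a"
    using i\<kappa> iK by (simp add: avg_def Kx.prob_space \<kappa>.prob_space)
  have "\<epsilon> * (\<integral>y. b - u y \<partial>\<kappa>) \<le> (\<integral>y. b - u y \<partial>K x)"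
    using bd x by (intro integral_minorization[where B="b - a"]) auto
  then have 2: "\<epsilon> * (b - ?k) \<le> b - avg K u x"
    using i\<kappa> iK by (simp add: avg_def Kx.prob_space \<kappa>.prob_space)
  show "avg K u x \<in> {a + \<epsilon> * (?k - a)..b - \<epsilon> * (b - ?k)}"
    using 1 2 by auto
qed

lemma measurable_avg_pow [measurable]:
  "u \<in> borel_measurable S \<Longrightarrow> (avg K ^^ n) u \<in> borel_measurable S"
  by (induction n) auto

lemma avg_pow_contraction:
  assumes u: "u \<in> borel_measurable S" "\<And>y. y \<in> space S \<Longrightarrow> u y \<in> {a..b}"
  shows "\<exists>a' b'. b' - a' = (1 - \<epsilon>) ^ n * (b - a) \<and> (\<forall>x\<in>space S. (avg K ^^ n) u x \<in> {a'..b'})"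
proof (induction n)
  case 0
  then show ?case using u(2) by (intro exI[of _ a] exI[of _ b]) auto
next
  case (Suc n)
  then obtain a' b' where ab: "b' - a' = (1 - \<epsilon>) ^ n * (b - a)"
    "\<And>x. x \<in> space S \<Longrightarrow> (avg K ^^ n) u x \<in> {a'..b'}" by blast
  obtain a'' b'' where "b'' - a'' = (1 - \<epsilon>) * (b' - a')"
    "\<And>x. x \<in> space S \<Longrightarrow> avg K ((avg K ^^ n) u) x \<in> {a''..b''}"
    using avg_contraction[OF measurable_avg_pow[OF u(1)] ab(2)] by blast
  then show ?case by (intro exI[of _ a''] exI[of _ b'']) (simp add: ab)
qed

end

locale stationary_minorized_kernel = minorized_kernel +
  fixes \<pi> :: "'a measure"
  assumes prob_\<pi>: "prob_space \<pi>" and sets_\<pi>: "sets \<pi> = sets S"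
    and stationary: "stationary_measure K \<pi>"
begin

lemma integral_avg:
  assumes u: "u \<in> borel_measurable S" "\<And>y. y \<in> space S \<Longrightarrow> \<bar>u y\<bar> \<le> B"
  shows "(\<integral>x. avg K u x \<partial>\<pi>) = (\<integral>x. u x \<partial>\<pi>)"
proof -
  interpret prob_space \<pi> by (rule prob_\<pi>)
  have K: "K \<in> \<pi> \<rightarrow>\<^sub>M subprob_algebra S"
    using kernel_subprob measurable_cong_sets[OF sets_\<pi> refl] by blast
  have [simp]: "space \<pi> = space S" using sets_\<pi> by (rule sets_eq_imp_space_eq)
  have "(\<integral>x. u x \<partial>(\<pi> \<bind> K)) = (\<integral>x. \<integral>y. u y \<partial>K x \<partial>\<pi>)"
    using prob_space_kernel
    by (intro integral_bind[OF u K, where B'=1] finite_measure_axioms)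
       (auto simp: prob_space.emeasure_space_1)
  then show ?thesis
    using stationary by (simp add: avg_def stationary_measure_def)
qed

text \<open>By stationarity the \<pi>-mean of \<open>u\<close> is also the \<pi>-mean of its
  \<open>n\<close>-th iterate. It therefore lies in the same shrunken interval as every value of
  that iterate; the initial interval is [-B, B], of length 2B.\<close>

lemma geometric_ergodicity:
  assumes u [measurable]: "u \<in> borel_measurable S" and bd: "\<And>y. y \<in> space S \<Longrightarrow> \<bar>u y\<bar> \<le> B"
    and x: "x \<in> space S"
  shows "\<bar>(avg K ^^ n) u x - (\<integral>y. u y \<partial>\<pi>)\<bar> \<le> (1 - \<epsilon>) ^ n * (2 * B)"
proof -
  interpret prob_space \<pi> by (rule prob_\<pi>)
  have [simp]: "space \<pi> = space S" using sets_\<pi> by (rule sets_eq_imp_space_eq)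
  have bd': "y \<in> space S \<Longrightarrow> u y \<in> {-B..B}" for y using bd[of y] by auto
  have ex: "\<exists>a b. b - a = (1 - \<epsilon>) ^ n * (2 * B) \<and> (\<forall>x\<in>space S. (avg K ^^ n) u x \<in> {a..b})" for n
    using avg_pow_contraction[OF u bd', of n] by simp
  have int: "(\<integral>y. (avg K ^^ n) u y \<partial>\<pi>) = (\<integral>y. u y \<partial>\<pi>)" for n
  proof (induction n)
    case (Suc n)
    obtain a b where "\<And>x. x \<in> space S \<Longrightarrow> (avg K ^^ n) u x \<in> {a..b}" using ex[of n] by blast
    then have "(\<integral>y. avg K ((avg K ^^ n) u) y \<partial>\<pi>) = (\<integral>y. (avg K ^^ n) u y \<partial>\<pi>)"
      by (intro integral_avg[where B="max \<bar>a\<bar> \<bar>b\<bar>"]) fastforce+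
    with Suc show ?case by simp
  qed simp
  obtain a b where ab: "b - a = (1 - \<epsilon>) ^ n * (2 * B)"
    "\<And>x. x \<in> space S \<Longrightarrow> (avg K ^^ n) u x \<in> {a..b}" using ex[of n] by blast
  have i: "integrable \<pi> ((avg K ^^ n) u)"
  proof (rule integrable_const_bound[where B="max \<bar>a\<bar> \<bar>b\<bar>"])
    show "AE x in \<pi>. norm ((avg K ^^ n) u x) \<le> max \<bar>a\<bar> \<bar>b\<bar>"
      using ab(2) by (intro AE_I2) fastforce
    show "(avg K ^^ n) u \<in> borel_measurable \<pi>"
      using measurable_avg_pow[OF u] measurable_cong_sets[OF sets_\<pi> refl] by blast
  qed
  have "a \<le> (\<integral>y. (avg K ^^ n) u y \<partial>\<pi>)"
    using ab(2) by (intro integral_ge_const[OF i]) auto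
  moreover have "(\<integral>y. (avg K ^^ n) u y \<partial>\<pi>) \<le> b"
    using ab(2) by (intro integral_le_const[OF i]) auto
  ultimately show ?thesis
    using ab(1) ab(2)[OF x] unfolding int by auto
qed

text \<open>The solution is the series of the centred iterates, dominated by a geometric series with
  ratio 1 - \<epsilon> and first term 2B; hence the bound 2B / \<epsilon>.\<close>

lemma poisson_equation:
  assumes u [measurable]: "u \<in> borel_measurable S" and bd: "\<And>y. y \<in> space S \<Longrightarrow> \<bar>u y\<bar> \<le> B"
  obtains h where "h \<in> borel_measurable S"
    and "\<And>x. x \<in> space S \<Longrightarrow> \<bar>h x\<bar> \<le> 2 * B / \<epsilon>"
    and "\<And>x. x \<in> space S \<Longrightarrow> h x - avg K h x = u x - (\<integral>y. u y \<partial>\<pi>)"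
proof
  define m where "m = (\<integral>y. u y \<partial>\<pi>)"
  define v where "v n x = (avg K ^^ n) u x - m" for n x
  have v [measurable]: "v n \<in> borel_measurable S" for n
    unfolding v_def by measurable
  have v_le: "\<bar>v n x\<bar> \<le> (1 - \<epsilon>) ^ n * (2 * B)" if "x \<in> space S" for n x
    using geometric_ergodicity[OF u bd that] by (simp add: v_def m_def)
  have geo: "(\<lambda>n. (1 - \<epsilon>) ^ n * (2 * B)) sums (1 / (1 - (1 - \<epsilon>)) * (2 * B))"
    using \<epsilon>_pos \<epsilon>_less_1 by (intro sums_mult2 geometric_sums) auto
  have sum_v: "summable (\<lambda>n. \<bar>v n x\<bar>)" if "x \<in> space S" for x
    by (rule summable_comparison_test_ev[OF _ sums_summable[OF geo]])
      (use v_le[OF that] in auto)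
  let ?h = "\<lambda>x. \<Sum>n. v n x"
  show "?h \<in> borel_measurable S" by measurable
  fix x assume x: "x \<in> space S"
  interpret Kx: prob_space "K x" using x by (rule prob_space_kernel)
  have "\<bar>?h x\<bar> \<le> (\<Sum>n. \<bar>v n x\<bar>)" by (rule summable_rabs[OF sum_v[OF x]])
  also have "\<dots> \<le> (\<Sum>n. (1 - \<epsilon>) ^ n * (2 * B))"
    by (intro suminf_le v_le x sum_v sums_summable[OF geo])
  also have "\<dots> = 2 * B / \<epsilon>" using sums_unique[OF geo] by simp
  finally show "\<bar>?h x\<bar> \<le> 2 * B / \<epsilon>" .
  have iu: "integrable (K x) ((avg K ^^ n) u)" for n
  proof (rule integrable_kernel[OF _ _ x])
    fix y assume "y \<in> space S"
    show "\<bar>(avg K ^^ n) u y\<bar> \<le> (1 - \<epsilon>) ^ n * (2 * B) + \<bar>m\<bar>"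
      using v_le[OF \<open>y \<in> space S\<close>, of n] by (auto simp: v_def)
  qed auto
  have iv: "integrable (K x) (v n)" for n unfolding v_def using iu by simp
  have step: "(\<integral>y. v n y \<partial>K x) = v (Suc n) x" for n
    using iu[of n] by (simp add: v_def avg_def Kx.prob_space)
  \<comment> \<open>\<open>K\<close> may be applied term by term because of the geometric
    domination. It shifts the index by one (\<open>step\<close>), so only the term of index 0, which
    is \<open>u x\<close> minus its \<pi>-mean, survives in the difference.\<close>
  have "avg K ?h x = (\<Sum>n. \<integral>y. v n y \<partial>K x)"
    unfolding avg_def
  proof (rule integral_suminf[OF iv])
    show "AE y in K x. summable (\<lambda>n. norm (v n y))"
      using sum_v by (intro AE_I2) (simp add: space_kernel_eq[OF x])
    show "summable (\<lambda>n. \<integral>y. norm (v n y) \<partial>K x)"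
    proof (rule summable_comparison_test_ev[OF _ sums_summable[OF geo]], intro always_eventually allI)
      fix n
      have "(\<integral>y. norm (v n y) \<partial>K x) \<le> (1 - \<epsilon>) ^ n * (2 * B)"
        using v_le iv by (intro Kx.integral_le_const AE_I2) (auto simp: space_kernel_eq[OF x])
      then show "norm (\<integral>y. norm (v n y) \<partial>K x) \<le> (1 - \<epsilon>) ^ n * (2 * B)"
        by simp
    qed
  qed
  also have "\<dots> = ?h x - v 0 x"
    using suminf_split_head[of "\<lambda>n. v n x"] summable_rabs_cancel[OF sum_v[OF x]] by (simp add: step)
  finally show "?h x - avg K ?h x = u x - (\<integral>y. u y \<partial>\<pi>)"
    by (simp add: v_def m_def)
qed

end

section \<open>Second moments along the chain\<close>

lemma measurable_chain_step:
  assumes [measurable]: "K \<in> S \<rightarrow>\<^sub>M prob_algebra S"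
  shows "(\<lambda>\<omega>. distr (K (\<omega> n)) (PiM {..Suc n} (\<lambda>_. S)) (\<lambda>x. fun_upd \<omega> (Suc n) x))
    \<in> PiM {..n} (\<lambda>_. S) \<rightarrow>\<^sub>M prob_algebra (PiM {..Suc n} (\<lambda>_. S))"
proof (rule measurable_distr_prob_space2)
  show "(\<lambda>\<omega>. K (\<omega> n)) \<in> PiM {..n} (\<lambda>_. S) \<rightarrow>\<^sub>M prob_algebra S"
    by (rule measurable_compose[OF measurable_component_singleton]) auto
  show "(\<lambda>(\<omega>, x). fun_upd \<omega> (Suc n) x) \<in> PiM {..n} (\<lambda>_. S) \<Otimes>\<^sub>M S \<rightarrow>\<^sub>M PiM {..Suc n} (\<lambda>_. S)"
    using measurable_add_dim[of "Suc n" "{..n}" "\<lambda>_. S"] by (simp add: atMost_Suc)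
qed

lemma chain_law_prob_algebra:
  assumes K: "K \<in> S \<rightarrow>\<^sub>M prob_algebra S" and \<mu>: "\<mu> \<in> space (prob_algebra S)"
  shows "chain_law S \<mu> K n \<in> space (prob_algebra (PiM {..n} (\<lambda>_. S)))"
proof (induction n)
  case 0
  interpret prob_space \<mu> using \<mu> by (simp add: space_prob_algebra)
  have "sets \<mu> = sets S" using \<mu> by (simp add: space_prob_algebra)
  then have "(\<lambda>x. \<lambda>i\<in>{..0::nat}. x) \<in> \<mu> \<rightarrow>\<^sub>M PiM {..0} (\<lambda>_. S)"
    by (intro measurable_restrict measurable_ident_sets)
  then have "prob_space (distr \<mu> (PiM {..0} (\<lambda>_. S)) (\<lambda>x. \<lambda>i\<in>{..0::nat}. x))"
    by (rule prob_space_distr)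
  then show ?case by (simp add: space_prob_algebra)
next
  case (Suc n)
  show ?case
    using prob_space_bind'[OF Suc measurable_chain_step[OF K, of n]]
      sets_bind'[OF Suc measurable_chain_step[OF K, of n]]
    by (simp add: space_prob_algebra)
qed

text \<open>The Markov property in the form used below: the inner integral is the conditional
  expectation of \<open>F\<close> given the points up to time \<open>n\<close>. Its integrability is
  recorded as well, because comparing it with a bound under the outer integral requires it.\<close>

lemma
  fixes F :: "(nat \<Rightarrow> 'x) \<Rightarrow> real"
  assumes K: "K \<in> S \<rightarrow>\<^sub>M prob_algebra S" and \<mu>: "\<mu> \<in> space (prob_algebra S)"
    and F: "F \<in> borel_measurable (PiM {..Suc n} (\<lambda>_. S))"
    and bd: "\<And>\<omega>. \<omega> \<in> space (PiM {..Suc n} (\<lambda>_. S)) \<Longrightarrow> \<bar>F \<omega>\<bar> \<le> B"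
  shows integral_chain_law_Suc: "(\<integral>\<omega>. F \<omega> \<partial>chain_law S \<mu> K (Suc n)) =
      (\<integral>\<omega>. \<integral>x. F (fun_upd \<omega> (Suc n) x) \<partial>K (\<omega> n) \<partial>chain_law S \<mu> K n)"
    and integrable_chain_law_Suc:
      "integrable (chain_law S \<mu> K n) (\<lambda>\<omega>. \<integral>x. F (fun_upd \<omega> (Suc n) x) \<partial>K (\<omega> n))"
proof -
  let ?P = "\<lambda>n. PiM {..n} (\<lambda>_. S)"
  let ?D = "\<lambda>\<omega>. distr (K (\<omega> n)) (?P (Suc n)) (\<lambda>x. fun_upd \<omega> (Suc n) x)"
  have C: "sets (chain_law S \<mu> K n) = sets (?P n)" "prob_space (chain_law S \<mu> K n)" for n
    using chain_law_prob_algebra[OF K \<mu>, of n] by (simp_all add: space_prob_algebra)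
  have sp: "space (chain_law S \<mu> K n) = space (?P n)" for n
    using C(1) by (rule sets_eq_imp_space_eq)
  have D: "?D \<in> chain_law S \<mu> K n \<rightarrow>\<^sub>M subprob_algebra (?P (Suc n))"
    using measurable_prob_algebraD[OF measurable_chain_step[OF K, of n]]
      measurable_cong_sets[OF C(1) refl] by blast
  have step: "(\<integral>\<omega>'. F \<omega>' \<partial>?D \<omega>) = (\<integral>x. F (fun_upd \<omega> (Suc n) x) \<partial>K (\<omega> n))"
    if \<omega>: "\<omega> \<in> space (chain_law S \<mu> K n)" for \<omega>
  proof (rule integral_distr)
    have \<omega>': "\<omega> \<in> space (?P n)" using \<omega> by (simp add: sp)
    then have "\<omega> n \<in> space S" by (auto simp: space_PiM)
    then have s: "sets (K (\<omega> n)) = sets S"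
      using measurable_space[OF K] by (auto simp: space_prob_algebra)
    have "(\<lambda>x. fun_upd \<omega> (Suc n) x) \<in> S \<rightarrow>\<^sub>M ?P (Suc n)"
      using measurable_compose[OF measurable_Pair1'[OF \<omega>']
          measurable_add_dim[of "Suc n" "{..n}" "\<lambda>_. S"]] by (simp add: atMost_Suc)
    then show "(\<lambda>x. fun_upd \<omega> (Suc n) x) \<in> K (\<omega> n) \<rightarrow>\<^sub>M ?P (Suc n)"
      using measurable_cong_sets[OF s refl] by blast
  qed (rule F)
  interpret Cn: prob_space "chain_law S \<mu> K (Suc n)" by (rule C)
  have "F \<in> borel_measurable (chain_law S \<mu> K (Suc n))"
    using F measurable_cong_sets[OF C(1) refl] by blast
  then have i: "integrable (chain_law S \<mu> K (Suc n)) F"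
    using bd by (intro Cn.integrable_const_bound[where B=B]) (auto simp only: sp real_norm_def intro: AE_I2)
  have i': "integrable (chain_law S \<mu> K n \<bind> ?D) F" using i by simp
  have s': "sets (chain_law S \<mu> K n \<bind> ?D) = sets (?P (Suc n))"
    using C(1)[of "Suc n"] by simp
  show "integrable (chain_law S \<mu> K n) (\<lambda>\<omega>. \<integral>x. F (fun_upd \<omega> (Suc n) x) \<partial>K (\<omega> n))"
    using integrable_integral_bind[OF D s' i'] step
    by (subst (asm) Bochner_Integration.integrable_cong[OF refl step]) auto
  have "(\<integral>\<omega>. F \<omega> \<partial>chain_law S \<mu> K (Suc n)) = (\<integral>\<omega>. \<integral>\<omega>'. F \<omega>' \<partial>?D \<omega> \<partial>chain_law S \<mu> K n)"
    using integral_bind_integrable[OF D s' i'] by simp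
  also have "\<dots> = (\<integral>\<omega>. \<integral>x. F (fun_upd \<omega> (Suc n) x) \<partial>K (\<omega> n) \<partial>chain_law S \<mu> K n)"
    by (intro Bochner_Integration.integral_cong step refl)
  finally show "(\<integral>\<omega>. F \<omega> \<partial>chain_law S \<mu> K (Suc n)) =
      (\<integral>\<omega>. \<integral>x. F (fun_upd \<omega> (Suc n) x) \<partial>K (\<omega> n) \<partial>chain_law S \<mu> K n)" .
qed

context stationary_minorized_kernel
begin

text \<open>With \<open>h\<close> solving the Poisson equation, \<open>T\<^sub>n = \<Sum>\<^sub>i\<^sub>\<le>\<^sub>n (u(X\<^sub>i) - \<pi>(u)) + (K h)(X\<^sub>n)\<close> satisfies
  \<open>E[T\<^sub>n\<^sub>+\<^sub>1\<^sup>2 | X\<^sub>0, \<dots>, X\<^sub>n] \<le> T\<^sub>n\<^sup>2 + (K h\<^sup>2)(X\<^sub>n)\<close>, because \<open>T\<^sub>n\<^sub>+\<^sub>1\<close> equals the \<open>n\<close>-th partial sum plus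
  \<open>h(X\<^sub>n\<^sub>+\<^sub>1)\<close>.\<close>

lemma chain_sum_second_moment:
  fixes u :: "'a \<Rightarrow> real"
  assumes u [measurable]: "u \<in> borel_measurable S" and bd: "\<And>y. y \<in> space S \<Longrightarrow> \<bar>u y\<bar> \<le> B"
    and \<mu>: "\<mu> \<in> space (prob_algebra S)"
  shows "(\<integral>\<omega>. (\<Sum>i\<le>n. u (\<omega> i) - (\<integral>y. u y \<partial>\<pi>))\<^sup>2 \<partial>chain_law S \<mu> K n)
    \<le> 4 * (2 * B / \<epsilon>)\<^sup>2 * real (n + 1)"
proof -
  let ?P = "\<lambda>n. PiM {..n} (\<lambda>_. S)"
  define D where "D = 2 * B / \<epsilon>"
  define v where "v x = u x - (\<integral>y. u y \<partial>\<pi>)" for x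
  obtain h where h [measurable]: "h \<in> borel_measurable S"
    and h_le: "\<And>x. x \<in> space S \<Longrightarrow> \<bar>h x\<bar> \<le> D"
    and h_eq: "\<And>x. x \<in> space S \<Longrightarrow> h x - avg K h x = v x"
    using poisson_equation[OF u bd] unfolding D_def v_def by metis
  define V where "V n \<omega> = (\<Sum>i\<le>n. v (\<omega> i))" for n and \<omega> :: "nat \<Rightarrow> 'a"
  define T where "T n \<omega> = V n \<omega> + avg K h (\<omega> n)" for n and \<omega> :: "nat \<Rightarrow> 'a"
  interpret \<mu>: prob_space \<mu> using \<mu> by (simp add: space_prob_algebra)
  have sets_\<mu>: "sets \<mu> = sets S" using \<mu> by (simp add: space_prob_algebra)
  have sp\<mu>: "space \<mu> = space S" using sets_\<mu> by (rule sets_eq_imp_space_eq)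
  have D0: "0 \<le> D" using h_le \<mu>.not_empty sp\<mu> by fastforce
  have [measurable]: "v \<in> borel_measurable S" unfolding v_def by measurable
  have avg_le: "\<bar>avg K h x\<bar> \<le> D" if x: "x \<in> space S" for x
  proof -
    interpret Kx: prob_space "K x" using x by (rule prob_space_kernel)
    have i: "integrable (K x) h" using integrable_kernel[OF h h_le x] .
    have "avg K h x \<le> D"
      unfolding avg_def using h_le
      by (intro Kx.integral_le_const[OF i] AE_I2) (force simp: space_kernel_eq[OF x])
    moreover have "- D \<le> avg K h x"
      unfolding avg_def using h_le
      by (intro Kx.integral_ge_const[OF i] AE_I2) (force simp: space_kernel_eq[OF x])
    ultimately show ?thesis by simp
  qed
  \<comment> \<open>The centred function is recovered as \<open>h\<close> minus its average, so all
    bounds are expressed through the single constant \<open>D\<close>.\<close>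
  have v_le: "\<bar>v x\<bar> \<le> 2 * D" if "x \<in> space S" for x
    using h_eq[OF that] h_le[OF that] avg_le[OF that] by linarith
  have V_meas [measurable]: "V n \<in> borel_measurable (?P m)" if "n \<le> m" for n m
    unfolding V_def using that
    by (intro borel_measurable_sum measurable_compose[OF measurable_component_singleton]) auto
  have T_meas [measurable]: "T n \<in> borel_measurable (?P n)" for n
    unfolding T_def
    by (intro borel_measurable_add V_meas measurable_compose[OF measurable_component_singleton]) auto
  have V_le: "\<bar>V n \<omega>\<bar> \<le> real (n + 1) * (2 * D)" if "\<omega> \<in> space (?P n)" for n \<omega>
  proof -
    have "\<bar>V n \<omega>\<bar> \<le> (\<Sum>i\<le>n. \<bar>v (\<omega> i)\<bar>)" unfolding V_def by (rule sum_abs)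
    also have "\<dots> \<le> (\<Sum>i\<le>n. 2 * D)"
      using that by (intro sum_mono v_le) (auto simp: space_PiM)
    finally show ?thesis by simp
  qed
  have T_le: "\<bar>T n \<omega>\<bar> \<le> real (n + 1) * (2 * D) + D" if "\<omega> \<in> space (?P n)" for n \<omega>
  proof -
    have "\<omega> n \<in> space S" using that by (auto simp: space_PiM)
    then show ?thesis using V_le[OF that] avg_le[of "\<omega> n"] unfolding T_def by linarith
  qed
  have T2_le: "\<bar>(T n \<omega>)\<^sup>2\<bar> \<le> (real (n + 1) * (2 * D) + D)\<^sup>2" if "\<omega> \<in> space (?P n)" for n \<omega>
    using power_mono[OF T_le[OF that], of 2] by simp
  have C: "sets (chain_law S \<mu> K n) = sets (?P n)" "prob_space (chain_law S \<mu> K n)" for n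
    using chain_law_prob_algebra[OF kernel \<mu>, of n] by (simp_all add: space_prob_algebra)
  have sp: "space (chain_law S \<mu> K n) = space (?P n)" for n
    using C(1) by (rule sets_eq_imp_space_eq)
  have chain_int: "integrable (chain_law S \<mu> K n) F"
    if F: "F \<in> borel_measurable (?P n)" and bF: "\<And>\<omega>. \<omega> \<in> space (?P n) \<Longrightarrow> \<bar>F \<omega>\<bar> \<le> b"
    for F n and b :: real
  proof -
    interpret prob_space "chain_law S \<mu> K n" by (rule C)
    have "F \<in> borel_measurable (chain_law S \<mu> K n)"
      using F measurable_cong_sets[OF C(1) refl] by blast
    then show ?thesis
      by (intro integrable_const_bound[where B=b] AE_I2) (auto simp only: sp real_norm_def bF)
  qed
  have T2_int: "integrable (chain_law S \<mu> K n) (\<lambda>\<omega>. (T n \<omega>)\<^sup>2)" for n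
    by (rule chain_int[OF _ T2_le]) measurable
  have bound: "(\<integral>\<omega>. (T n \<omega>)\<^sup>2 \<partial>chain_law S \<mu> K n) \<le> D\<^sup>2 * real (n + 1)" for n
  proof (induction n)
    case 0
    interpret C0: prob_space "chain_law S \<mu> K 0" by (rule C)
    show ?case
    proof -
      \<comment> \<open>By the Poisson equation \<open>T 0\<close> collapses to \<open>h\<close> at
        the starting point, so the induction starts from any initial law.\<close>
      have "(T 0 \<omega>)\<^sup>2 \<le> D\<^sup>2" if "\<omega> \<in> space (?P 0)" for \<omega>
      proof -
        have "\<omega> 0 \<in> space S" using that by (auto simp: space_PiM)
        then have "\<bar>T 0 \<omega>\<bar> \<le> D"
          using h_eq[of "\<omega> 0"] h_le[of "\<omega> 0"] by (simp add: T_def V_def)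
        then show ?thesis using power_mono[of "\<bar>T 0 \<omega>\<bar>" D 2] by simp
      qed
      then have "(\<integral>\<omega>. (T 0 \<omega>)\<^sup>2 \<partial>chain_law S \<mu> K 0) \<le> D\<^sup>2"
        by (intro C0.integral_le_const T2_int AE_I2) (simp only: sp)
      then show ?thesis by simp
    qed
  next
    case (Suc n)
    interpret Cn: prob_space "chain_law S \<mu> K n" by (rule C)
    let ?I = "\<lambda>\<omega>. \<integral>x. (T (Suc n) (fun_upd \<omega> (Suc n) x))\<^sup>2 \<partial>K (\<omega> n)"
    have meas: "(\<lambda>\<omega>. (T (Suc n) \<omega>)\<^sup>2) \<in> borel_measurable (?P (Suc n))" by measurable
    have "(\<integral>\<omega>. (T (Suc n) \<omega>)\<^sup>2 \<partial>chain_law S \<mu> K (Suc n)) = (\<integral>\<omega>. ?I \<omega> \<partial>chain_law S \<mu> K n)"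
      by (rule integral_chain_law_Suc[OF kernel \<mu> meas T2_le])
    also have "\<dots> \<le> (\<integral>\<omega>. (T n \<omega>)\<^sup>2 + D\<^sup>2 \<partial>chain_law S \<mu> K n)"
    proof (rule integral_mono)
      show "integrable (chain_law S \<mu> K n) ?I"
        by (rule integrable_chain_law_Suc[OF kernel \<mu> meas T2_le])
      show "integrable (chain_law S \<mu> K n) (\<lambda>\<omega>. (T n \<omega>)\<^sup>2 + D\<^sup>2)"
        using T2_int by simp
      fix \<omega> assume "\<omega> \<in> space (chain_law S \<mu> K n)"
      then have x: "\<omega> n \<in> space S" by (auto simp: sp space_PiM)
      interpret Kx: prob_space "K (\<omega> n)" using x by (rule prob_space_kernel)
      have h2: "\<bar>(h y)\<^sup>2\<bar> \<le> D\<^sup>2" if "y \<in> space S" for y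
        using power_mono[OF h_le[OF that], of 2] by simp
      have ih: "integrable (K (\<omega> n)) h" using integrable_kernel[OF h h_le x] .
      have ih2: "integrable (K (\<omega> n)) (\<lambda>y. (h y)\<^sup>2)"
        by (rule integrable_kernel[OF _ h2 x]) measurable
      \<comment> \<open>Moving to time n + 1 replaces the average of \<open>h\<close> at the old
        point by \<open>h\<close> at the new one. In the expanded square the cross term integrates
        to \<open>2 * V n \<omega> * avg K h (\<omega> n)\<close>, exactly what completes the square
        of \<open>T n\<close>.\<close>
      have "?I \<omega> = (\<integral>y. (V n \<omega>)\<^sup>2 + 2 * V n \<omega> * h y + (h y)\<^sup>2 \<partial>K (\<omega> n))"
      proof (rule Bochner_Integration.integral_cong[OF refl])
        fix y assume "y \<in> space (K (\<omega> n))"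
        then have "y \<in> space S" by (simp add: space_kernel_eq[OF x])
        have "(\<Sum>i\<le>n. v ((fun_upd \<omega> (Suc n) y) i)) = V n \<omega>"
          unfolding V_def by (intro sum.cong) auto
        then have "T (Suc n) (fun_upd \<omega> (Suc n) y) = V n \<omega> + h y"
          using h_eq[OF \<open>y \<in> space S\<close>] by (simp add: T_def V_def)
        then show "(T (Suc n) (fun_upd \<omega> (Suc n) y))\<^sup>2 = (V n \<omega>)\<^sup>2 + 2 * V n \<omega> * h y + (h y)\<^sup>2"
          by (simp add: power2_sum)
      qed
      also have "\<dots> = (V n \<omega>)\<^sup>2 + 2 * V n \<omega> * avg K h (\<omega> n) + (\<integral>y. (h y)\<^sup>2 \<partial>K (\<omega> n))"
        using ih ih2 by (simp add: avg_def Kx.prob_space)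
      \<comment> \<open>The subtracted square in the conditional variance of \<open>h\<close> is
        dropped, leaving an increment of at most \<open>D\<close> squared per step.\<close>
      also have "\<dots> \<le> (V n \<omega>)\<^sup>2 + 2 * V n \<omega> * avg K h (\<omega> n) + (avg K h (\<omega> n))\<^sup>2 + D\<^sup>2"
      proof -
        have "(\<integral>y. (h y)\<^sup>2 \<partial>K (\<omega> n)) \<le> D\<^sup>2"
          using h2 by (intro Kx.integral_le_const ih2 AE_I2) (simp add: space_kernel_eq[OF x])
        then show ?thesis using zero_le_power2[of "avg K h (\<omega> n)"] by linarith
      qed
      finally show "?I \<omega> \<le> (T n \<omega>)\<^sup>2 + D\<^sup>2"
        by (simp add: T_def power2_sum)
    qed
    also have "\<dots> = (\<integral>\<omega>. (T n \<omega>)\<^sup>2 \<partial>chain_law S \<mu> K n) + D\<^sup>2"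
      using T2_int by (simp add: Cn.prob_space)
    finally show ?case using Suc by (simp add: algebra_simps)
  qed
  interpret Cn: prob_space "chain_law S \<mu> K n" by (rule C)
  have V2_int: "integrable (chain_law S \<mu> K n) (\<lambda>\<omega>. (V n \<omega>)\<^sup>2)"
  proof (rule chain_int)
    fix \<omega> assume "\<omega> \<in> space (?P n)"
    from power_mono[OF V_le[OF this], of 2] show "\<bar>(V n \<omega>)\<^sup>2\<bar> \<le> (real (n + 1) * (2 * D))\<^sup>2" by simp
  qed measurable
  have "(\<integral>\<omega>. (V n \<omega>)\<^sup>2 \<partial>chain_law S \<mu> K n) \<le> (\<integral>\<omega>. 2 * (T n \<omega>)\<^sup>2 + 2 * D\<^sup>2 \<partial>chain_law S \<mu> K n)"
  proof (rule integral_mono[OF V2_int])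
    fix \<omega> assume "\<omega> \<in> space (chain_law S \<mu> K n)"
    then have "\<omega> n \<in> space S" by (auto simp: sp space_PiM)
    then have "(avg K h (\<omega> n))\<^sup>2 \<le> D\<^sup>2"
      using power_mono[OF avg_le, of "\<omega> n" 2] by simp
    \<comment> \<open>\<open>V\<close> is \<open>T\<close> minus the correction term; the inequality
      is the nonnegativity of the square of their sum.\<close>
    moreover have "(V n \<omega>)\<^sup>2 \<le> 2 * (T n \<omega>)\<^sup>2 + 2 * (avg K h (\<omega> n))\<^sup>2"
      using zero_le_power2[of "T n \<omega> + avg K h (\<omega> n)"]
      by (simp add: T_def power2_eq_square algebra_simps)
    ultimately show "(V n \<omega>)\<^sup>2 \<le> 2 * (T n \<omega>)\<^sup>2 + 2 * D\<^sup>2" by linarith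
  qed (use T2_int in simp)
  also have "\<dots> = 2 * (\<integral>\<omega>. (T n \<omega>)\<^sup>2 \<partial>chain_law S \<mu> K n) + 2 * D\<^sup>2"
    using T2_int by (simp add: Cn.prob_space)
  also have "\<dots> \<le> 2 * (D\<^sup>2 * real (n + 1)) + 2 * D\<^sup>2" using bound[of n] by linarith
  also have "\<dots> \<le> 4 * D\<^sup>2 * real (n + 1)" by (simp add: algebra_simps)
  finally show ?thesis by (simp only: V_def v_def D_def)
qed

end

section \<open>Pooled means and plug-in values\<close>

text \<open>The constant 12 comes from the recursion a(j+1) \<le> 3/2 a(j) + 3 C 2^(j+1): a bound A
  C 2^j propagates exactly when 3/2 A + 6 \<le> 2 A. No relation between the summands is
  assumed.\<close>

lemma second_moment_sum_geometric:
  fixes X :: "nat \<Rightarrow> 'b \<Rightarrow> real"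
  assumes X [measurable]: "\<And>p. p \<in> {1..j} \<Longrightarrow> X p \<in> borel_measurable M"
    and int: "\<And>p. p \<in> {1..j} \<Longrightarrow> integrable M (\<lambda>\<omega>. (X p \<omega>)\<^sup>2)"
    and le: "\<And>p. p \<in> {1..j} \<Longrightarrow> (\<integral>\<omega>. (X p \<omega>)\<^sup>2 \<partial>M) \<le> C * 2 ^ p"
    and C: "0 \<le> C"
  shows "integrable M (\<lambda>\<omega>. (\<Sum>p=1..j. X p \<omega>)\<^sup>2) \<and> (\<integral>\<omega>. (\<Sum>p=1..j. X p \<omega>)\<^sup>2 \<partial>M) \<le> 12 * C * 2 ^ j"
  using assms(1-3)
proof (induction j)
  case 0
  then show ?case using C by simp
next
  case (Suc j)
  let ?V = "\<lambda>\<omega>. \<Sum>p=1..j. X p \<omega>"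
  note [measurable] = Suc.prems(1)
  have IH: "integrable M (\<lambda>\<omega>. (?V \<omega>)\<^sup>2)" "(\<integral>\<omega>. (?V \<omega>)\<^sup>2 \<partial>M) \<le> 12 * C * 2 ^ j"
    using Suc.IH Suc.prems by auto
  have iX: "integrable M (\<lambda>\<omega>. (X (Suc j) \<omega>)\<^sup>2)" and eX: "(\<integral>\<omega>. (X (Suc j) \<omega>)\<^sup>2 \<partial>M) \<le> C * 2 ^ Suc j"
    using Suc.prems(2,3)[of "Suc j"] by auto
  \<comment> \<open>The factor \<open>3 / 2\<close> has to be below the growth rate \<open>2\<close> for the induction to close.\<close>
  have young: "(a + b)\<^sup>2 \<le> 3 / 2 * a\<^sup>2 + 3 * b\<^sup>2" for a b :: real
    using zero_le_power2[of "a - 2 * b"] by (simp add: power2_eq_square algebra_simps)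
  have bd: "(\<Sum>p=1..Suc j. X p \<omega>)\<^sup>2 \<le> 3 / 2 * (?V \<omega>)\<^sup>2 + 3 * (X (Suc j) \<omega>)\<^sup>2" for \<omega>
    using young[of "?V \<omega>" "X (Suc j) \<omega>"] by simp
  have i: "integrable M (\<lambda>\<omega>. 3 / 2 * (?V \<omega>)\<^sup>2 + 3 * (X (Suc j) \<omega>)\<^sup>2)"
    using IH iX by auto
  have i': "integrable M (\<lambda>\<omega>. (\<Sum>p=1..Suc j. X p \<omega>)\<^sup>2)"
  proof (rule Bochner_Integration.integrable_bound[OF i])
    show "AE \<omega> in M. norm ((\<Sum>p=1..Suc j. X p \<omega>)\<^sup>2) \<le> norm (3 / 2 * (?V \<omega>)\<^sup>2 + 3 * (X (Suc j) \<omega>)\<^sup>2)"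
      using bd by (intro AE_I2) simp
  qed measurable
  have "(\<integral>\<omega>. (\<Sum>p=1..Suc j. X p \<omega>)\<^sup>2 \<partial>M) \<le> (\<integral>\<omega>. 3 / 2 * (?V \<omega>)\<^sup>2 + 3 * (X (Suc j) \<omega>)\<^sup>2 \<partial>M)"
    by (rule integral_mono[OF i' i bd])
  also have "\<dots> = 3 / 2 * (\<integral>\<omega>. (?V \<omega>)\<^sup>2 \<partial>M) + 3 * (\<integral>\<omega>. (X (Suc j) \<omega>)\<^sup>2 \<partial>M)"
    using IH iX by simp
  also have "\<dots> \<le> 12 * C * 2 ^ Suc j"
    using IH(2) eX by simp
  finally show ?case using i' by blast
qed

text \<open>Run lengths telescope to \<open>level_size l\<close>, and the \<open>l\<close> initial
  draws add the rest. Thus the weights in \<open>pooled_mean\<close> sum to 1 for l \<ge> 1.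
  Monotonicity of \<open>level_size\<close> keeps the subtraction of naturals from
  truncating.\<close>

lemma sum_run_length: "(\<Sum>p=1..l. real (run_length p + 1)) = real (level_size l + l)"
proof (induction l)
  case (Suc l)
  have "level_size l \<le> level_size (Suc l)"
    by (auto simp: level_size_def)
  with Suc show ?case by (simp add: run_length_def)
qed (simp add: level_size_def)

lemma run_length_le: "real (run_length p + 1) \<le> 2 * 2 ^ p"
proof -
  have "run_length p \<le> 2 ^ p" by (auto simp: run_length_def level_size_def)
  moreover have "(1::nat) \<le> 2 ^ p" by simp
  ultimately have "run_length p + 1 \<le> 2 * 2 ^ p" by linarith
  then have "real (run_length p + 1) \<le> real (2 * 2 ^ p)" by (simp only: of_nat_le_iff)
  then show ?thesis by simp
qed

text \<open>The weight of a run cancels its own normalization, so the pooled mean is the plain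
  average over all points of all runs. At l = 0 it would be the empty sum 0 and could not be
  centred.\<close>

lemma pooled_mean_centered:
  fixes m :: "'b::real_vector"
  assumes "1 \<le> l"
  shows "pooled_mean l \<omega> u - m =
    (1 / real (level_size l + l)) *\<^sub>R (\<Sum>p=1..l. \<Sum>i\<le>run_length p. u (\<omega> p i) - m)"
proof -
  let ?W = "real (level_size l + l)"
  have W: "?W \<noteq> 0" using assms by simp
  have "(\<Sum>p=1..l. \<Sum>i\<le>run_length p. u (\<omega> p i) - m) =
      (\<Sum>p=1..l. \<Sum>i\<le>run_length p. u (\<omega> p i)) - (\<Sum>p=1..l. real (run_length p + 1)) *\<^sub>R m"
    by (simp add: sum_subtractf sum_constant_scaleR scaleR_sum_left)
  moreover have "pooled_mean l \<omega> u = (1 / ?W) *\<^sub>R (\<Sum>p=1..l. \<Sum>i\<le>run_length p. u (\<omega> p i))"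
    unfolding pooled_mean_def empirical_mean_def scaleR_sum_right
    by (intro sum.cong refl) (simp add: field_simps)
  ultimately show ?thesis
    unfolding sum_run_length using W by (simp add: scaleR_diff_right)
qed

lemma runs_law_prob_space:
  assumes "K \<in> S \<rightarrow>\<^sub>M prob_algebra S" "\<mu> \<in> space (prob_algebra S)"
  shows "prob_space (runs_law S \<mu> K l)"
  using chain_law_prob_algebra[OF assms] unfolding runs_law_def
  by (intro prob_space_PiM) (auto simp: space_prob_algebra)

lemma measurable_run_point:
  assumes "K \<in> S \<rightarrow>\<^sub>M prob_algebra S" "\<mu> \<in> space (prob_algebra S)"
    and "p \<in> {1..l}" "i \<le> run_length p" and u: "u \<in> S \<rightarrow>\<^sub>M N"
  shows "(\<lambda>\<omega>. u (\<omega> p i)) \<in> runs_law S \<mu> K l \<rightarrow>\<^sub>M N"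
proof -
  have "sets (chain_law S \<mu> K (run_length p)) = sets (PiM {..run_length p} (\<lambda>_. S))"
    using chain_law_prob_algebra[OF assms(1,2)] by (simp add: space_prob_algebra)
  moreover have "(\<lambda>\<omega>. u (\<omega> i)) \<in> PiM {..run_length p} (\<lambda>_. S) \<rightarrow>\<^sub>M N"
    using assms(4) by (intro measurable_compose[OF _ u] measurable_component_singleton) auto
  ultimately have "(\<lambda>\<omega>. u (\<omega> i)) \<in> chain_law S \<mu> K (run_length p) \<rightarrow>\<^sub>M N"
    using measurable_cong_sets by blast
  then show ?thesis
    unfolding runs_law_def using assms(3)
    by (intro measurable_compose[OF measurable_component_singleton]) auto
qed

lemma measurable_pooled_mean:
  fixes u :: "'x \<Rightarrow> 'b::euclidean_space"
  assumes "K \<in> S \<rightarrow>\<^sub>M prob_algebra S" "\<mu> \<in> space (prob_algebra S)"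
    and "l' \<le> l" and "u \<in> borel_measurable S"
  shows "(\<lambda>\<omega>. pooled_mean l' \<omega> u) \<in> borel_measurable (runs_law S \<mu> K l)"
  unfolding pooled_mean_def empirical_mean_def using assms
  by (intro borel_measurable_sum borel_measurable_scaleR borel_measurable_const measurable_run_point) auto

context stationary_minorized_kernel
begin

lemma pooled_mean_second_moment_real:
  fixes u :: "'a \<Rightarrow> real"
  assumes u [measurable]: "u \<in> borel_measurable S" and bd: "\<And>y. y \<in> space S \<Longrightarrow> \<bar>u y\<bar> \<le> B"
    and \<mu>: "\<mu> \<in> space (prob_algebra S)" and l: "1 \<le> l"
  shows "integrable (runs_law S \<mu> K l) (\<lambda>\<omega>. (pooled_mean l \<omega> u - (\<integral>y. u y \<partial>\<pi>))\<^sup>2) \<and>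
    (\<integral>\<omega>. (pooled_mean l \<omega> u - (\<integral>y. u y \<partial>\<pi>))\<^sup>2 \<partial>runs_law S \<mu> K l) \<le> 96 * (2 * B / \<epsilon>)\<^sup>2 / 2 ^ l"
proof -
  let ?R = "runs_law S \<mu> K l" and ?m = "\<integral>y. u y \<partial>\<pi>"
  let ?C = "\<lambda>p. chain_law S \<mu> K (run_length p)"
  define X where "X p \<omega> = (\<Sum>i\<le>run_length p. u (\<omega> p i) - ?m)" for p and \<omega> :: "nat \<Rightarrow> nat \<Rightarrow> 'a"
  \<comment> \<open>A run contributes 4 (2B / \<epsilon>)^2 per point and has at most 2 * 2^p
    points.\<close>
  define c where "c = 8 * (2 * B / \<epsilon>)\<^sup>2"
  have C: "sets (?C p) = sets (PiM {..run_length p} (\<lambda>_. S))" "prob_space (?C p)" for p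
    using chain_law_prob_algebra[OF kernel \<mu>, of "run_length p"] by (simp_all add: space_prob_algebra)
  have X_meas: "X p \<in> borel_measurable ?R" if "p \<in> {1..l}" for p
    unfolding X_def using that
    by (intro borel_measurable_sum borel_measurable_diff measurable_run_point kernel \<mu> u) auto
  have X_prop: "integrable ?R (\<lambda>\<omega>. (X p \<omega>)\<^sup>2) \<and> (\<integral>\<omega>. (X p \<omega>)\<^sup>2 \<partial>?R) \<le> c * 2 ^ p"
    if p: "p \<in> {1..l}" for p
  proof -
    let ?Y = "\<lambda>\<omega>. (\<Sum>i\<le>run_length p. u (\<omega> i) - ?m)\<^sup>2"
    interpret Cp: prob_space "?C p" by (rule C)
    have "(\<lambda>\<omega>. u (\<omega> i)) \<in> borel_measurable (PiM {..run_length p} (\<lambda>_. S))" if "i \<le> run_length p" for i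
      using that by (intro measurable_compose[OF _ u] measurable_component_singleton) auto
    then have "?Y \<in> borel_measurable (PiM {..run_length p} (\<lambda>_. S))"
      by (intro borel_measurable_power borel_measurable_sum borel_measurable_diff) auto
    then have Y: "?Y \<in> borel_measurable (?C p)"
      using measurable_cong_sets[OF C(1) refl] by blast
    have iY: "integrable (?C p) ?Y"
    proof (rule Cp.integrable_const_bound[OF AE_I2 Y])
      fix \<omega> assume "\<omega> \<in> space (?C p)"
      then have "i \<le> run_length p \<Longrightarrow> \<omega> i \<in> space S" for i
        unfolding sets_eq_imp_space_eq[OF C(1)] by (auto simp: space_PiM)
      then have "\<bar>\<Sum>i\<le>run_length p. u (\<omega> i) - ?m\<bar> \<le> (\<Sum>i\<le>run_length p. B + \<bar>?m\<bar>)"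
        using bd by (intro order_trans[OF sum_abs sum_mono] order_trans[OF abs_triangle_ineq4] add_mono) auto
      from power_mono[OF this, of 2]
      show "norm (?Y \<omega>) \<le> (\<Sum>i\<le>run_length p. B + \<bar>?m\<bar>)\<^sup>2" by simp
    qed
    \<comment> \<open>The joint law of the runs enters only through its marginals: run
      \<open>p\<close> alone has the law of one chain.\<close>
    have distr: "distr ?R (?C p) (\<lambda>\<omega>. \<omega> p) = ?C p"
      unfolding runs_law_def by (rule distr_PiM_component[OF C(2) p])
    have proj: "(\<lambda>\<omega>. \<omega> p) \<in> ?R \<rightarrow>\<^sub>M ?C p"
      unfolding runs_law_def using p by (intro measurable_component_singleton)
    have eq: "(X p \<omega>)\<^sup>2 = ?Y (\<omega> p)" for \<omega> by (simp add: X_def)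
    have i: "integrable ?R (\<lambda>\<omega>. (X p \<omega>)\<^sup>2)"
      unfolding eq using iY integrable_distr_eq[OF proj Y] by (simp add: distr)
    have "(\<integral>\<omega>. (X p \<omega>)\<^sup>2 \<partial>?R) = (\<integral>\<omega>. ?Y \<omega> \<partial>?C p)"
      unfolding eq using integral_distr[OF proj Y] by (simp add: distr)
    also have "\<dots> \<le> 4 * (2 * B / \<epsilon>)\<^sup>2 * real (run_length p + 1)"
      by (rule chain_sum_second_moment[OF u bd \<mu>])
    also have "\<dots> \<le> 4 * (2 * B / \<epsilon>)\<^sup>2 * (2 * 2 ^ p)"
      by (intro mult_left_mono run_length_le) auto
    also have "\<dots> = c * 2 ^ p" by (simp add: c_def)
    finally show ?thesis using i by blast
  qed
  have main: "integrable ?R (\<lambda>\<omega>. (\<Sum>p=1..l. X p \<omega>)\<^sup>2) \<and> (\<integral>\<omega>. (\<Sum>p=1..l. X p \<omega>)\<^sup>2 \<partial>?R) \<le> 12 * c * 2 ^ l"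
    using X_meas X_prop by (intro second_moment_sum_geometric) (auto simp: c_def)
  let ?W = "real (level_size l + l)"
  have eq: "(pooled_mean l \<omega> u - ?m)\<^sup>2 = (1 / ?W)\<^sup>2 * (\<Sum>p=1..l. X p \<omega>)\<^sup>2" for \<omega>
    unfolding pooled_mean_centered[OF l] X_def by (simp add: power_divide)
  have W: "2 ^ l \<le> ?W" using l by (simp add: level_size_def)
  have "(\<integral>\<omega>. (pooled_mean l \<omega> u - ?m)\<^sup>2 \<partial>?R) = (1 / ?W)\<^sup>2 * (\<integral>\<omega>. (\<Sum>p=1..l. X p \<omega>)\<^sup>2 \<partial>?R)"
    unfolding eq by simp
  \<comment> \<open>Dividing by the square of at least 2^l points turns growth 2^l into decay 2^-l;
    the constant 96 is 12 times the 8 in \<open>c\<close>.\<close>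
  also have "\<dots> \<le> (1 / 2 ^ l)\<^sup>2 * (12 * c * 2 ^ l)"
  proof (intro mult_mono power_mono)
    show "1 / ?W \<le> 1 / 2 ^ l" using W by (intro frac_le) auto
  qed (use main in \<open>auto simp: c_def\<close>)
  also have "\<dots> = 96 * (2 * B / \<epsilon>)\<^sup>2 / 2 ^ l"
    by (simp add: c_def power2_eq_square)
  finally show ?thesis
    unfolding eq using main by (intro conjI integrable_mult_right) auto
qed

text \<open>The squared norm is the sum over the basis of squared real errors. Each coordinate
  inherits the bound \<open>B\<close>, so only a factor DIM is lost.\<close>

lemma pooled_mean_second_moment:
  fixes u :: "'a \<Rightarrow> 'b::euclidean_space"
  assumes u [measurable]: "u \<in> borel_measurable S" and bd: "\<And>y. y \<in> space S \<Longrightarrow> norm (u y) \<le> B"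
    and \<mu>: "\<mu> \<in> space (prob_algebra S)" and l: "1 \<le> l"
  shows "integrable (runs_law S \<mu> K l) (\<lambda>\<omega>. (norm (pooled_mean l \<omega> u - (\<integral>y. u y \<partial>\<pi>)))\<^sup>2) \<and>
    (\<integral>\<omega>. (norm (pooled_mean l \<omega> u - (\<integral>y. u y \<partial>\<pi>)))\<^sup>2 \<partial>runs_law S \<mu> K l)
      \<le> real DIM('b) * (96 * (2 * B / \<epsilon>)\<^sup>2) / 2 ^ l"
proof -
  let ?R = "runs_law S \<mu> K l" and ?m = "\<integral>y. u y \<partial>\<pi>"
  interpret prob_space \<pi> by (rule prob_\<pi>)
  have "u \<in> borel_measurable \<pi>"
    using u measurable_cong_sets[OF sets_\<pi> refl] by blast
  then have iu: "integrable \<pi> u"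
    using bd by (intro integrable_const_bound[where B=B] AE_I2)
      (auto simp: sets_eq_imp_space_eq[OF sets_\<pi>])
  have inner: "(pooled_mean l \<omega> u - ?m) \<bullet> b = pooled_mean l \<omega> (\<lambda>y. u y \<bullet> b) - (\<integral>y. u y \<bullet> b \<partial>\<pi>)" for b \<omega>
    using iu by (simp add: inner_diff_left pooled_mean_def empirical_mean_def inner_sum_left)
  have eq: "(norm (pooled_mean l \<omega> u - ?m))\<^sup>2 =
      (\<Sum>b\<in>Basis. (pooled_mean l \<omega> (\<lambda>y. u y \<bullet> b) - (\<integral>y. u y \<bullet> b \<partial>\<pi>))\<^sup>2)" for \<omega>
    unfolding power2_norm_eq_inner inner[symmetric]
    by (subst euclidean_inner) (simp add: power2_eq_square)
  have each: "integrable ?R (\<lambda>\<omega>. (pooled_mean l \<omega> (\<lambda>y. u y \<bullet> b) - (\<integral>y. u y \<bullet> b \<partial>\<pi>))\<^sup>2) \<and>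
      (\<integral>\<omega>. (pooled_mean l \<omega> (\<lambda>y. u y \<bullet> b) - (\<integral>y. u y \<bullet> b \<partial>\<pi>))\<^sup>2 \<partial>?R) \<le> 96 * (2 * B / \<epsilon>)\<^sup>2 / 2 ^ l"
    if "b \<in> Basis" for b
    using bd Basis_le_norm[OF that] order_trans
    by (intro pooled_mean_second_moment_real[OF _ _ \<mu> l]) (measurable, blast)
  have "(\<integral>\<omega>. (norm (pooled_mean l \<omega> u - ?m))\<^sup>2 \<partial>?R) =
      (\<Sum>b\<in>Basis. \<integral>\<omega>. (pooled_mean l \<omega> (\<lambda>y. u y \<bullet> b) - (\<integral>y. u y \<bullet> b \<partial>\<pi>))\<^sup>2 \<partial>?R)"
    unfolding eq using each by (intro Bochner_Integration.integral_sum) auto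
  also have "\<dots> \<le> (\<Sum>b\<in>(Basis :: 'b set). 96 * (2 * B / \<epsilon>)\<^sup>2 / 2 ^ l)"
    using each by (intro sum_mono) auto
  finally show ?thesis
    unfolding eq using each by (auto intro!: Bochner_Integration.integrable_sum)
qed

end

section \<open>The plug-in map: measurability and stability\<close>

text \<open>Because of the transpose, the product is a combination of the rows of \<open>D\<close>
  weighted by the gradient. Measurability and norm bounds thereby reduce to single rows.\<close>

lemma plug_in_eq_sum: "plug_in df D v = (\<Sum>j\<in>UNIV. (df v $ j) *\<^sub>R (D $ j))"
  by (simp add: plug_in_def vec_eq_iff matrix_vector_mult_def transpose_def mult.commute)

lemma measurable_vec_nth:
  "(\<lambda>w :: 'c::euclidean_space ^ 'n::finite. w $ j) \<in> borel_measurable borel"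
  by (intro borel_measurable_continuous_onI continuous_on_component continuous_on_id)

lemma measurable_plug_in:
  assumes [measurable]: "df \<in> borel_measurable borel" "D \<in> borel_measurable M" "v \<in> borel_measurable M"
  shows "(\<lambda>x. plug_in df (D x) (v x)) \<in> borel_measurable M"
proof -
  have "(\<lambda>x. df (v x) $ j) \<in> borel_measurable M" "(\<lambda>x. D x $ j) \<in> borel_measurable M" for j
    by (intro measurable_compose[OF _ measurable_vec_nth]; measurable)+
  then show ?thesis
    unfolding plug_in_eq_sum by (intro borel_measurable_sum borel_measurable_scaleR)
qed

lemma norm_transpose_mult_vec_le:
  fixes D :: "real^'k^'k" and w :: "real^'k"
  shows "norm (transpose D *v w) \<le> real CARD('k) * (norm D * norm w)"
proof -
  \<comment> \<open>A constant gradient makes the row expansion available for an arbitrary vector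
    \<open>w\<close>.\<close>
  have "norm (plug_in (\<lambda>_. w) D 0) \<le> (\<Sum>j\<in>(UNIV :: 'k set). norm D * norm w)"
    unfolding plug_in_eq_sum
  proof (rule order_trans[OF norm_sum sum_mono])
    fix j :: 'k
    have "norm (w $ j) * norm (D $ j) \<le> norm w * norm D"
      by (intro mult_mono Finite_Cartesian_Product.norm_nth_le) auto
    then show "norm ((w $ j) *\<^sub>R (D $ j)) \<le> norm D * norm w" by (simp add: mult.commute)
  qed
  then show ?thesis by (simp add: plug_in_def)
qed

text \<open>The difference is split asymmetrically: the matrix error meets the bounded gradient at
  \<open>v\<close>, and the gradient error meets \<open>D'\<close>. In use \<open>D'\<close> is the
  deterministic limit, so its norm is a constant and the right-hand side is linear in the two
  squared errors.\<close>

lemma plug_in_diff_sq_le: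
  fixes df :: "real^'k \<Rightarrow> real^'k"
  assumes bd: "norm (df v) \<le> F" and lip: "norm (df v - df v') \<le> L * norm (v - v')"
  shows "(norm (plug_in df D v - plug_in df D' v'))\<^sup>2 \<le>
    2 * (real CARD('k))\<^sup>2 * (F\<^sup>2 * (norm (D - D'))\<^sup>2 + (norm D' * L)\<^sup>2 * (norm (v - v'))\<^sup>2)"
proof -
  let ?k = "real CARD('k)"
  have "plug_in df D v - plug_in df D' v' = plug_in df (D - D') v + transpose D' *v (df v - df v')"
    by (simp add: plug_in_def vec_eq_iff matrix_vector_mult_def transpose_def
        sum_subtractf[symmetric] sum.distrib[symmetric] algebra_simps)
  also have "norm \<dots> \<le> ?k * (norm (D - D') * norm (df v)) + ?k * (norm D' * norm (df v - df v'))"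
    unfolding plug_in_def
    by (intro order_trans[OF norm_triangle_ineq] add_mono norm_transpose_mult_vec_le)
  also have "\<dots> \<le> ?k * (norm (D - D') * F) + ?k * (norm D' * (L * norm (v - v')))"
    using bd lip by (intro add_mono mult_left_mono) auto
  finally have "(norm (plug_in df D v - plug_in df D' v'))\<^sup>2 \<le>
      (?k * (norm (D - D') * F) + ?k * (norm D' * (L * norm (v - v'))))\<^sup>2"
    by (intro power_mono) auto
  also have "\<dots> \<le> 2 * (?k * (norm (D - D') * F))\<^sup>2 + 2 * (?k * (norm D' * (L * norm (v - v'))))\<^sup>2"
    using zero_le_power2[of "?k * (norm (D - D') * F) - ?k * (norm D' * (L * norm (v - v')))"]
    unfolding power2_sum power2_diff by linarith
  also have "\<dots> = 2 * ?k\<^sup>2 * (F\<^sup>2 * (norm (D - D'))\<^sup>2 + (norm D' * L)\<^sup>2 * (norm (v - v'))\<^sup>2)"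
    by (simp add: power_mult_distrib algebra_simps)
  finally show ?thesis .
qed

context stationary_minorized_kernel
begin

lemma plug_in_second_moment:
  fixes u :: "'a \<Rightarrow> real^'k" and A :: "'a \<Rightarrow> real^'k^'k"
  assumes u: "u \<in> borel_measurable S" "\<And>y. y \<in> space S \<Longrightarrow> norm (u y) \<le> B"
    and A: "A \<in> borel_measurable S" "\<And>y. y \<in> space S \<Longrightarrow> norm (A y) \<le> B'"
    and df: "df \<in> borel_measurable borel" "\<And>v. norm (df v) \<le> F"
      "\<And>v v'. norm (df v - df v') \<le> L * norm (v - v')"
    and \<mu>: "\<mu> \<in> space (prob_algebra S)"
  shows "\<exists>c. \<forall>l\<ge>1.
    integrable (runs_law S \<mu> K l) (\<lambda>\<omega>. (norm (plug_in df (pooled_mean l \<omega> A) (pooled_mean l \<omega> u)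
      - plug_in df (\<integral>y. A y \<partial>\<pi>) (\<integral>y. u y \<partial>\<pi>)))\<^sup>2) \<and>
    (\<integral>\<omega>. (norm (plug_in df (pooled_mean l \<omega> A) (pooled_mean l \<omega> u)
      - plug_in df (\<integral>y. A y \<partial>\<pi>) (\<integral>y. u y \<partial>\<pi>)))\<^sup>2 \<partial>runs_law S \<mu> K l) \<le> c / 2 ^ l"
proof -
  let ?mA = "\<integral>y. A y \<partial>\<pi>" and ?mu = "\<integral>y. u y \<partial>\<pi>" and ?k = "real CARD('k)"
  define cA where "cA = real DIM(real^'k^'k) * (96 * (2 * B' / \<epsilon>)\<^sup>2)"
  define cu where "cu = real DIM(real^'k) * (96 * (2 * B / \<epsilon>)\<^sup>2)"
  show ?thesis
  \<comment> \<open>The witness stays schematic and is fixed by the last bound. It depends on the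
    limiting matrix, \<open>F\<close>, \<open>L\<close>, \<open>cA\<close> and \<open>cu\<close>,
    but not on \<open>l\<close>.\<close>
  proof (intro exI allI impI)
    fix l :: nat assume l: "1 \<le> l"
    let ?R = "runs_law S \<mu> K l"
    let ?dA = "\<lambda>\<omega>. (norm (pooled_mean l \<omega> A - ?mA))\<^sup>2" and ?du = "\<lambda>\<omega>. (norm (pooled_mean l \<omega> u - ?mu))\<^sup>2"
    let ?Q = "\<lambda>\<omega>. (norm (plug_in df (pooled_mean l \<omega> A) (pooled_mean l \<omega> u) - plug_in df ?mA ?mu))\<^sup>2"
    let ?b = "\<lambda>\<omega>. 2 * ?k\<^sup>2 * (F\<^sup>2 * ?dA \<omega> + (norm ?mA * L)\<^sup>2 * ?du \<omega>)"
    have dA: "integrable ?R ?dA" "(\<integral>\<omega>. ?dA \<omega> \<partial>?R) \<le> cA / 2 ^ l"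
      using pooled_mean_second_moment[OF A \<mu> l] by (simp_all add: cA_def)
    have du: "integrable ?R ?du" "(\<integral>\<omega>. ?du \<omega> \<partial>?R) \<le> cu / 2 ^ l"
      using pooled_mean_second_moment[OF u \<mu> l] by (simp_all add: cu_def)
    have le: "?Q \<omega> \<le> ?b \<omega>" for \<omega>
      by (rule plug_in_diff_sq_le[OF df(2,3)])
    have [measurable]: "(\<lambda>\<omega>. pooled_mean l \<omega> A) \<in> borel_measurable ?R"
      "(\<lambda>\<omega>. pooled_mean l \<omega> u) \<in> borel_measurable ?R"
      using A u by (auto intro: measurable_pooled_mean kernel \<mu>)
    have [measurable]: "(\<lambda>\<omega>. plug_in df (pooled_mean l \<omega> A) (pooled_mean l \<omega> u)) \<in> borel_measurable ?R"
      by (intro measurable_plug_in df(1)) measurable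
    have Q: "?Q \<in> borel_measurable ?R" by measurable
    have ib: "integrable ?R ?b" using dA du by auto
    have iQ: "integrable ?R ?Q"
      by (rule Bochner_Integration.integrable_bound[OF ib Q], rule AE_I2)
        (use le order_trans[OF le abs_ge_self] in auto)
    have "(\<integral>\<omega>. ?Q \<omega> \<partial>?R) \<le> (\<integral>\<omega>. ?b \<omega> \<partial>?R)"
      by (rule integral_mono[OF iQ ib le])
    also have "\<dots> = 2 * ?k\<^sup>2 * (F\<^sup>2 * (\<integral>\<omega>. ?dA \<omega> \<partial>?R) + (norm ?mA * L)\<^sup>2 * (\<integral>\<omega>. ?du \<omega> \<partial>?R))"
      using dA du by simp
    also have "\<dots> \<le> 2 * ?k\<^sup>2 * (F\<^sup>2 * (cA / 2 ^ l) + (norm ?mA * L)\<^sup>2 * (cu / 2 ^ l))"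
      using dA du by (intro mult_left_mono add_mono) auto
    also have "\<dots> = 2 * ?k\<^sup>2 * (F\<^sup>2 * cA + (norm ?mA * L)\<^sup>2 * cu) / 2 ^ l"
      by (simp add: field_simps)
    finally show "integrable ?R ?Q \<and> (\<integral>\<omega>. ?Q \<omega> \<partial>?R) \<le> 2 * ?k\<^sup>2 * (F\<^sup>2 * cA + (norm ?mA * L)\<^sup>2 * cu) / 2 ^ l"
      using iQ by blast
  qed
qed

end

section \<open>Randomized telescoping\<close>

text \<open>Importance weighting of a random term of a series: the mass of a level cancels one
  factor \<open>1 / pmf P l\<close> in the mean, and one of two in the second moment. Levels of mass
  zero carry no moment hypothesis; there the weight is 0, by division by zero, and the series has
  the term 0.\<close>

lemma randomized_sum_estimator:
  fixes R :: "nat \<Rightarrow> 'w measure" and Y :: "nat \<Rightarrow> 'w \<Rightarrow> 'b::euclidean_space" and P :: "nat pmf"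
  assumes R: "\<And>l. prob_space (R l)" and Y [measurable]: "\<And>l. Y l \<in> borel_measurable (R l)"
    and int: "\<And>l. pmf P l \<noteq> 0 \<Longrightarrow> integrable (R l) (\<lambda>\<omega>. (norm (Y l \<omega>))\<^sup>2)"
    and le: "\<And>l. pmf P l \<noteq> 0 \<Longrightarrow> (\<integral>\<omega>. (norm (Y l \<omega>))\<^sup>2 \<partial>R l) \<le> b l"
    and b: "\<And>l. 0 \<le> b l" "summable (\<lambda>l. b l / pmf P l)"
    and sums: "(\<lambda>l. if pmf P l = 0 then 0 else \<integral>\<omega>. Y l \<omega> \<partial>R l) sums H"
  defines "Q \<equiv> measure_pmf P \<bind> (\<lambda>l. distr (R l) borel (\<lambda>\<omega>. (1 / pmf P l) *\<^sub>R Y l \<omega>))"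
  shows "integrable Q (\<lambda>h. h)" and "(\<integral>h. h \<partial>Q) = H"
    and "(\<integral>\<^sup>+h. ennreal ((norm h)\<^sup>2) \<partial>Q) < \<infinity>"
proof -
  let ?N = "\<lambda>l. distr (R l) borel (\<lambda>\<omega>. (1 / pmf P l) *\<^sub>R Y l \<omega>)"
  have kern: "?N \<in> measure_pmf P \<rightarrow>\<^sub>M prob_algebra borel"
    using R by (auto simp: space_prob_algebra intro!: prob_space.prob_space_distr)
  then have kern': "?N \<in> measure_pmf P \<rightarrow>\<^sub>M subprob_algebra borel"
    by (rule measurable_prob_algebraD)
  have PP: "measure_pmf P \<in> space (prob_algebra (measure_pmf P))"
    by (simp add: space_prob_algebra measure_pmf.prob_space_axioms)
  have sets_Q: "sets Q = sets borel" and "prob_space Q"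
    unfolding Q_def by (rule sets_bind'[OF PP kern], rule prob_space_bind'[OF PP kern])
  interpret Q: prob_space Q by fact
  have int_Y: "integrable (R l) (Y l)" if "pmf P l \<noteq> 0" for l
  proof (rule Bochner_Integration.integrable_bound)
    interpret prob_space "R l" by (rule R)
    show "integrable (R l) (\<lambda>\<omega>. 1 + (norm (Y l \<omega>))\<^sup>2)" using int[OF that] by simp
    have "norm y \<le> 1 + (norm y)\<^sup>2" for y :: 'b
      using zero_le_power2[of "norm y - 1"] norm_ge_zero[of y] unfolding power2_diff
      by (smt (verit) power_one mult_1_right)
    then show "AE \<omega> in R l. norm (Y l \<omega>) \<le> norm (1 + (norm (Y l \<omega>))\<^sup>2)" by simp
  qed measurable
  have "(\<integral>\<^sup>+h. ennreal ((norm h)\<^sup>2) \<partial>Q) = (\<integral>\<^sup>+l. \<integral>\<^sup>+h. ennreal ((norm h)\<^sup>2) \<partial>?N l \<partial>P)"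
    unfolding Q_def by (rule nn_integral_bind[OF _ kern']) measurable
  also have "\<dots> = (\<integral>\<^sup>+l. \<integral>\<^sup>+\<omega>. ennreal ((norm ((1 / pmf P l) *\<^sub>R Y l \<omega>))\<^sup>2) \<partial>R l \<partial>P)"
    by (intro nn_integral_cong nn_integral_distr) measurable
  also have "\<dots> = (\<Sum>l. ennreal (pmf P l) * (\<integral>\<^sup>+\<omega>. ennreal ((norm ((1 / pmf P l) *\<^sub>R Y l \<omega>))\<^sup>2) \<partial>R l))"
    by (simp only: nn_integral_measure_pmf nn_integral_count_space_nat)
  also have "\<dots> \<le> (\<Sum>l. ennreal (b l / pmf P l))"
  proof (rule suminf_le)
    fix l
    show "ennreal (pmf P l) * (\<integral>\<^sup>+\<omega>. ennreal ((norm ((1 / pmf P l) *\<^sub>R Y l \<omega>))\<^sup>2) \<partial>R l) \<le> ennreal (b l / pmf P l)"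
    proof (cases "pmf P l = 0")
      case False
      let ?q = "(1 / pmf P l)\<^sup>2"
      have "(\<integral>\<^sup>+\<omega>. ennreal ((norm ((1 / pmf P l) *\<^sub>R Y l \<omega>))\<^sup>2) \<partial>R l) =
          (\<integral>\<^sup>+\<omega>. ennreal (?q * (norm (Y l \<omega>))\<^sup>2) \<partial>R l)"
        by (simp add: power_mult_distrib power_divide)
      also have "\<dots> = ennreal (\<integral>\<omega>. ?q * (norm (Y l \<omega>))\<^sup>2 \<partial>R l)"
        using int[OF False] by (intro nn_integral_eq_integral) auto
      also have "\<dots> \<le> ennreal (?q * b l)"
        using mult_left_mono[OF le[OF False], of ?q] by (intro ennreal_leI) simp
      finally have "ennreal (pmf P l) * (\<integral>\<^sup>+\<omega>. ennreal ((norm ((1 / pmf P l) *\<^sub>R Y l \<omega>))\<^sup>2) \<partial>R l)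
          \<le> ennreal (pmf P l) * ennreal (?q * b l)"
        by (rule mult_left_mono) simp
      also have "\<dots> = ennreal (b l / pmf P l)"
        using False b(1) by (simp add: ennreal_mult'[symmetric] power2_eq_square)
      finally show ?thesis .
    qed simp
  qed auto
  also have "\<dots> = ennreal (\<Sum>l. b l / pmf P l)"
    using b by (intro suminf_ennreal_eq summable_sums) auto
  finally show fin: "(\<integral>\<^sup>+h. ennreal ((norm h)\<^sup>2) \<partial>Q) < \<infinity>"
    by (rule order.strict_trans1) simp
  have meas: "f \<in> borel_measurable Q" if "f \<in> borel_measurable borel" for f :: "'b \<Rightarrow> 'c::topological_space"
    using that measurable_cong_sets[OF sets_Q refl] by blast
  have iQ2: "integrable Q (\<lambda>h. (norm h)\<^sup>2)"
    using fin by (intro integrableI_bounded meas) auto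
  \<comment> \<open>A norm is at most 1 plus its square, so the second moment just obtained controls
    the first.\<close>
  show iQ: "integrable Q (\<lambda>h. h)"
  proof (rule Bochner_Integration.integrable_bound)
    show "integrable Q (\<lambda>h. 1 + (norm h)\<^sup>2)" using iQ2 by simp
    have "norm y \<le> 1 + (norm y)\<^sup>2" for y :: 'b
      using zero_le_power2[of "norm y - 1"] norm_ge_zero[of y] unfolding power2_diff
      by (smt (verit) power_one mult_1_right)
    then show "AE h in Q. norm h \<le> norm (1 + (norm h)\<^sup>2)" by simp
  qed (rule meas, simp)
  show "(\<integral>h. h \<partial>Q) = H"
  \<comment> \<open>The disintegration formula is available for real integrands, hence the test
    against basis vectors.\<close>
  proof (rule euclidean_eqI)
    fix e :: 'b assume "e \<in> Basis"
    let ?g = "\<lambda>l. \<integral>h. h \<bullet> e \<partial>?N l"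
    have ie: "integrable Q (\<lambda>h. h \<bullet> e)" using iQ by simp
    have mean: "(\<integral>h. h \<bullet> e \<partial>Q) = (\<integral>l. ?g l \<partial>P)" and ig: "integrable P ?g"
      using integral_bind_integrable[OF kern' sets_Q[unfolded Q_def] ie[unfolded Q_def]]
        integrable_integral_bind[OF kern' sets_Q[unfolded Q_def] ie[unfolded Q_def]]
      by (simp_all add: Q_def)
    \<comment> \<open>Integrability over the levels is absolute summability, so the mean is the sum
      of this series; uniqueness of sums then identifies it with the component of
      \<open>H\<close>.\<close>
    have "integrable (count_space UNIV) (\<lambda>l. pmf P l *\<^sub>R ?g l)"
      using ig unfolding measure_pmf_eq_density by (subst (asm) integrable_density) auto
    then have "(\<lambda>l. pmf P l *\<^sub>R ?g l) sums (\<integral>l. pmf P l *\<^sub>R ?g l \<partial>count_space UNIV)"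
      by (rule sums_integral_count_space_nat)
    also have "(\<integral>l. pmf P l *\<^sub>R ?g l \<partial>count_space UNIV) = (\<integral>l. ?g l \<partial>P)"
      unfolding measure_pmf_eq_density by (subst integral_density) auto
    also have "(\<lambda>l. pmf P l *\<^sub>R ?g l) = (\<lambda>l. (if pmf P l = 0 then 0 else \<integral>\<omega>. Y l \<omega> \<partial>R l) \<bullet> e)"
    proof
      fix l
      have "?g l = (\<integral>\<omega>. ((1 / pmf P l) *\<^sub>R Y l \<omega>) \<bullet> e \<partial>R l)"
        by (rule integral_distr) measurable
      also have "pmf P l *\<^sub>R \<dots> = (if pmf P l = 0 then 0 else \<integral>\<omega>. Y l \<omega> \<partial>R l) \<bullet> e"
        using int_Y[of l] by simp
      finally show "pmf P l *\<^sub>R ?g l = (if pmf P l = 0 then 0 else \<integral>\<omega>. Y l \<omega> \<partial>R l) \<bullet> e" .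
    qed
    finally have "(\<lambda>l. (if pmf P l = 0 then 0 else \<integral>\<omega>. Y l \<omega> \<partial>R l) \<bullet> e) sums (\<integral>l. ?g l \<partial>P)" .
    moreover have "(\<lambda>l. (if pmf P l = 0 then 0 else \<integral>\<omega>. Y l \<omega> \<partial>R l) \<bullet> e) sums (H \<bullet> e)"
      using sums by (rule bounded_linear.sums[OF bounded_linear_inner_left])
    ultimately have "(\<integral>l. ?g l \<partial>P) = H \<bullet> e" by (rule sums_unique2)
    then show "(\<integral>h. h \<partial>Q) \<bullet> e = H \<bullet> e"
      using mean iQ by simp
  qed
qed

text \<open>The first \<open>l'\<close> of \<open>l\<close> runs are jointly distributed as
  \<open>runs_law\<close> at \<open>l'\<close>, being a marginal of a product. Dependence on those
  runs alone is expressed by invariance under \<open>restrict\<close>.\<close>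

lemma
  fixes F :: "(nat \<Rightarrow> nat \<Rightarrow> 'x) \<Rightarrow> 'b::{banach, second_countable_topology}"
  assumes K: "K \<in> S \<rightarrow>\<^sub>M prob_algebra S" and \<mu>: "\<mu> \<in> space (prob_algebra S)"
    and l: "l' \<le> l" and F: "F \<in> borel_measurable (runs_law S \<mu> K l')"
    and restr: "\<And>\<omega>. F (restrict \<omega> {1..l'}) = F \<omega>"
  shows integral_runs_law_restrict: "(\<integral>\<omega>. F \<omega> \<partial>runs_law S \<mu> K l) = (\<integral>\<omega>. F \<omega> \<partial>runs_law S \<mu> K l')"
    and integrable_runs_law_restrict:
      "integrable (runs_law S \<mu> K l) F \<longleftrightarrow> integrable (runs_law S \<mu> K l') F"
proof -
  let ?r = "\<lambda>\<omega>. \<lambda>p\<in>{1..l'}. \<omega> p"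
  have distr: "distr (runs_law S \<mu> K l) (runs_law S \<mu> K l') ?r = runs_law S \<mu> K l'"
    unfolding runs_law_def using l chain_law_prob_algebra[OF K \<mu>]
    by (intro distr_PiM_reindex[where f="\<lambda>p. p"]) (auto simp: space_prob_algebra)
  have r: "?r \<in> runs_law S \<mu> K l \<rightarrow>\<^sub>M runs_law S \<mu> K l'"
    unfolding runs_law_def using l by (intro measurable_restrict measurable_component_singleton) auto
  show "(\<integral>\<omega>. F \<omega> \<partial>runs_law S \<mu> K l) = (\<integral>\<omega>. F \<omega> \<partial>runs_law S \<mu> K l')"
    using integral_distr[OF r F] unfolding distr restr by simp
  show "integrable (runs_law S \<mu> K l) F \<longleftrightarrow> integrable (runs_law S \<mu> K l') F"
    using integrable_distr_eq[OF r F] unfolding distr restr by simp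
qed

lemma pooled_mean_restrict: "pooled_mean l (restrict \<omega> {1..l}) u = pooled_mean l \<omega> u"
  unfolding pooled_mean_def by (intro sum.cong) auto

text \<open>The single weight is (2 + 1) / (2 + 1) = 1. This makes the separate branch L = 1 the
  first term of the telescoping sum.\<close>

lemma pooled_mean_1: "pooled_mean 1 \<omega> u = empirical_mean (level_size 1) (\<omega> 1) u"
  by (simp add: pooled_mean_def run_length_def level_size_def)

context stationary_minorized_kernel
begin

text \<open>\<open>G l\<close> is the plug-in value at level \<open>l\<close> and \<open>Y l\<close>
  its increment, with the value before level 1 read as 0. Convergence of the means of
  \<open>G l\<close> to \<open>H\<close> gives unbiasedness; increments of order 2^-l in mean square
  give the second moment.\<close>

lemma telescoping_estimator:
  fixes u :: "'a \<Rightarrow> real^'k" and A :: "'a \<Rightarrow> real^'k^'k" and P :: "nat pmf" and c \<beta> :: real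
  assumes u: "u \<in> borel_measurable S" "\<And>y. y \<in> space S \<Longrightarrow> norm (u y) \<le> B"
    and A: "A \<in> borel_measurable S" "\<And>y. y \<in> space S \<Longrightarrow> norm (A y) \<le> B'"
    and df: "df \<in> borel_measurable borel" "\<And>v. norm (df v) \<le> F"
      "\<And>v v'. norm (df v - df v') \<le> L * norm (v - v')"
    and \<mu>: "\<mu> \<in> space (prob_algebra S)"
    and P: "\<And>l. pmf P l = (if l = 0 then 0 else c * 2 powr (- \<beta> * real l))" and \<beta>: "\<beta> < 1"
  defines "H \<equiv> plug_in df (\<integral>y. A y \<partial>\<pi>) (\<integral>y. u y \<partial>\<pi>)"
    and "G \<equiv> \<lambda>l \<omega>. plug_in df (pooled_mean l \<omega> A) (pooled_mean l \<omega> u)"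
  defines "Y \<equiv> \<lambda>l \<omega>. if l = 1 then G 1 \<omega> else G l \<omega> - G (l - 1) \<omega>"
  defines "Q \<equiv> measure_pmf P \<bind> (\<lambda>l. distr (runs_law S \<mu> K l) borel (\<lambda>\<omega>. (1 / pmf P l) *\<^sub>R Y l \<omega>))"
  shows "integrable Q (\<lambda>h. h)" and "(\<integral>h. h \<partial>Q) = H"
    and "(\<integral>\<^sup>+h. ennreal ((norm h)\<^sup>2) \<partial>Q) < \<infinity>"
proof -
  let ?R = "runs_law S \<mu> K"
  have R: "prob_space (?R l)" for l by (rule runs_law_prob_space[OF kernel \<mu>])
  have c: "0 < c"
  proof -
    have "0 \<le> c * 2 powr (- \<beta> * real 1)" using P[of 1] pmf_nonneg[of P 1] by simp
    then have "0 \<le> c" by (simp add: zero_le_mult_iff)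
    \<comment> \<open>A zero constant would leave the probability mass function without
      support.\<close>
    moreover have "c \<noteq> 0"
    proof
      assume "c = 0"
      then have "set_pmf P = {}" using P by (auto simp: set_pmf_eq)
      then show False using set_pmf_not_empty by blast
    qed
    ultimately show ?thesis by simp
  qed
  have P0: "pmf P l = 0 \<longleftrightarrow> l = 0" for l using c by (simp add: P)
  have G_meas: "G l' \<in> borel_measurable (?R l)" if "l' \<le> l" for l' l
    unfolding G_def using that
    by (intro measurable_plug_in df(1) measurable_pooled_mean kernel \<mu> A(1) u(1)) auto
  have G_restr: "G l (restrict \<omega> {1..l}) = G l \<omega>" for l \<omega>
    unfolding G_def pooled_mean_restrict ..
  obtain a where a: "\<And>l. 1 \<le> l \<Longrightarrow> integrable (?R l) (\<lambda>\<omega>. (norm (G l \<omega> - H))\<^sup>2)"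
    "\<And>l. 1 \<le> l \<Longrightarrow> (\<integral>\<omega>. (norm (G l \<omega> - H))\<^sup>2 \<partial>?R l) \<le> a / 2 ^ l"
    using plug_in_second_moment[OF u A df \<mu>] unfolding G_def H_def by blast
  have a0: "0 \<le> a"
  proof -
    have "0 \<le> (\<integral>\<omega>. (norm (G 1 \<omega> - H))\<^sup>2 \<partial>?R 1)" by simp
    also have "\<dots> \<le> a / 2 ^ 1" by (rule a) simp
    finally show ?thesis by simp
  qed
  have a': "integrable (?R l) (\<lambda>\<omega>. (norm (G l' \<omega> - H))\<^sup>2)"
    "(\<integral>\<omega>. (norm (G l' \<omega> - H))\<^sup>2 \<partial>?R l) \<le> a / 2 ^ l'" if "1 \<le> l'" "l' \<le> l" for l' l
  proof -
    have m: "(\<lambda>\<omega>. (norm (G l' \<omega> - H))\<^sup>2) \<in> borel_measurable (?R l')"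
      using G_meas[of l' l'] by measurable
    note * = kernel \<mu> that(2) m
    show "integrable (?R l) (\<lambda>\<omega>. (norm (G l' \<omega> - H))\<^sup>2)"
      using integrable_runs_law_restrict[OF *] a(1)[OF that(1)] G_restr by simp
    show "(\<integral>\<omega>. (norm (G l' \<omega> - H))\<^sup>2 \<partial>?R l) \<le> a / 2 ^ l'"
      using integral_runs_law_restrict[OF *] a(2)[OF that(1)] G_restr by simp
  qed
  have G_int: "integrable (?R l) (G l')" and G_dev: "(norm ((\<integral>\<omega>. G l' \<omega> \<partial>?R l) - H))\<^sup>2 \<le> a / 2 ^ l'"
    if l: "1 \<le> l'" "l' \<le> l" for l' l
  proof -
    interpret prob_space "?R l" by (rule R)
    have [measurable]: "G l' \<in> borel_measurable (?R l)" by (rule G_meas[OF l(2)])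
    have i: "integrable (?R l) (\<lambda>\<omega>. norm (G l' \<omega> - H))"
      by (rule square_integrable_imp_integrable[OF _ a'(1)[OF l]]) measurable
    then have i': "integrable (?R l) (\<lambda>\<omega>. G l' \<omega> - H)"
      by (subst (asm) integrable_norm_iff) measurable
    then have "integrable (?R l) (\<lambda>\<omega>. (G l' \<omega> - H) + H)"
      by (intro Bochner_Integration.integrable_add) auto
    then show iG: "integrable (?R l) (G l')" by simp
    have "norm ((\<integral>\<omega>. G l' \<omega> \<partial>?R l) - H) = norm (\<integral>\<omega>. G l' \<omega> - H \<partial>?R l)"
      using iG by (simp add: prob_space)
    also have "\<dots> \<le> (\<integral>\<omega>. norm (G l' \<omega> - H) \<partial>?R l)" by (rule integral_norm_bound)
    finally have "(norm ((\<integral>\<omega>. G l' \<omega> \<partial>?R l) - H))\<^sup>2 \<le> (\<integral>\<omega>. norm (G l' \<omega> - H) \<partial>?R l)\<^sup>2"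
      by (rule power_mono) simp
    \<comment> \<open>Jensen, obtained from the nonnegativity of the variance of the norm: the
      squared bias is below the mean squared error.\<close>
    also have "\<dots> \<le> (\<integral>\<omega>. (norm (G l' \<omega> - H))\<^sup>2 \<partial>?R l)"
      using variance_positive[of "\<lambda>\<omega>. norm (G l' \<omega> - H)"] variance_eq[OF i a'(1)[OF l]] by simp
    also have "\<dots> \<le> a / 2 ^ l'" by (rule a'(2)[OF l])
    finally show "(norm ((\<integral>\<omega>. G l' \<omega> \<partial>?R l) - H))\<^sup>2 \<le> a / 2 ^ l'" .
  qed
  have Y_meas: "Y l \<in> borel_measurable (?R l)" for l
    using G_meas[of l l] G_meas[of "l - 1" l] unfolding Y_def by (cases "l = 1") auto
  \<comment> \<open>2 a from the current level plus twice the bound 2 a + 2 (norm H)^2 on the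
    previous one; the term with \<open>H\<close> serves l = 1, where the previous value is
    0.\<close>
  define d where "d = 6 * a + 4 * (norm H)\<^sup>2"
  have sq: "(norm (x - y))\<^sup>2 \<le> 2 * (norm x)\<^sup>2 + 2 * (norm y)\<^sup>2" for x y :: "real^'k"
  proof -
    have "(norm (x - y))\<^sup>2 \<le> (norm x + norm y)\<^sup>2" by (intro power_mono norm_triangle_ineq4) simp
    then show ?thesis
      using zero_le_power2[of "norm x - norm y"] unfolding power2_sum power2_diff by linarith
  qed
  have Y_moment: "integrable (?R l) (\<lambda>\<omega>. (norm (Y l \<omega>))\<^sup>2) \<and> (\<integral>\<omega>. (norm (Y l \<omega>))\<^sup>2 \<partial>?R l) \<le> d / 2 ^ l"
    if l: "1 \<le> l" for l
  proof -
    interpret prob_space "?R l" by (rule R)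
    note [measurable] = Y_meas[of l]
    define Z where "Z \<omega> = (if l = 1 then - H else G (l - 1) \<omega> - H)" for \<omega>
    have Z: "integrable (?R l) (\<lambda>\<omega>. (norm (Z \<omega>))\<^sup>2)"
      "(\<integral>\<omega>. (norm (Z \<omega>))\<^sup>2 \<partial>?R l) \<le> (2 * a + 2 * (norm H)\<^sup>2) / 2 ^ l"
    proof -
      show "integrable (?R l) (\<lambda>\<omega>. (norm (Z \<omega>))\<^sup>2)"
        using a'(1)[of "l - 1" l] integrable_const[of "(norm H)\<^sup>2"] l
        by (cases "l = 1") (auto simp: Z_def)
      show "(\<integral>\<omega>. (norm (Z \<omega>))\<^sup>2 \<partial>?R l) \<le> (2 * a + 2 * (norm H)\<^sup>2) / 2 ^ l"
      proof (cases "l = 1")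
        case True
        then show ?thesis using a0 prob_space by (simp add: Z_def)
      next
        case False
        then have "(\<integral>\<omega>. (norm (Z \<omega>))\<^sup>2 \<partial>?R l) \<le> a / 2 ^ (l - 1)"
          using a'(2)[of "l - 1" l] l by (simp add: Z_def)
        also have "\<dots> = 2 * a / 2 ^ l" using l by (cases l) auto
        also have "\<dots> \<le> (2 * a + 2 * (norm H)\<^sup>2) / 2 ^ l" by (intro divide_right_mono) auto
        finally show ?thesis .
      qed
    qed
    have YZ: "(norm (Y l \<omega>))\<^sup>2 \<le> 2 * (norm (G l \<omega> - H))\<^sup>2 + 2 * (norm (Z \<omega>))\<^sup>2" for \<omega>
    proof -
      have "Y l \<omega> = (G l \<omega> - H) - Z \<omega>" by (simp add: Y_def Z_def)
      then show ?thesis using sq by simp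
    qed
    have ib: "integrable (?R l) (\<lambda>\<omega>. 2 * (norm (G l \<omega> - H))\<^sup>2 + 2 * (norm (Z \<omega>))\<^sup>2)"
      using Z(1) a(1)[OF l] by simp
    have iY: "integrable (?R l) (\<lambda>\<omega>. (norm (Y l \<omega>))\<^sup>2)"
    proof (rule Bochner_Integration.integrable_bound[OF ib])
      show "AE \<omega> in ?R l. norm ((norm (Y l \<omega>))\<^sup>2) \<le> norm (2 * (norm (G l \<omega> - H))\<^sup>2 + 2 * (norm (Z \<omega>))\<^sup>2)"
        using YZ by (intro AE_I2) simp
    qed measurable
    have "(\<integral>\<omega>. (norm (Y l \<omega>))\<^sup>2 \<partial>?R l) \<le> (\<integral>\<omega>. 2 * (norm (G l \<omega> - H))\<^sup>2 + 2 * (norm (Z \<omega>))\<^sup>2 \<partial>?R l)"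
      by (rule integral_mono[OF iY ib YZ])
    also have "\<dots> = 2 * (\<integral>\<omega>. (norm (G l \<omega> - H))\<^sup>2 \<partial>?R l) + 2 * (\<integral>\<omega>. (norm (Z \<omega>))\<^sup>2 \<partial>?R l)"
      using Z(1) a(1)[OF l] by simp
    also have "\<dots> \<le> 2 * (a / 2 ^ l) + 2 * ((2 * a + 2 * (norm H)\<^sup>2) / 2 ^ l)"
      using Z(2) a(2)[OF l] by linarith
    also have "\<dots> = d / 2 ^ l" by (simp add: d_def field_simps)
    finally show ?thesis using iY by blast
  qed
  define s where "s l = (if l = 0 then 0 else \<integral>\<omega>. G l \<omega> \<partial>?R l)" for l
  \<comment> \<open>Since \<open>s 0\<close> is 0 and 0 - 1 = 0 for naturals, the formula covers l =
    0 (no mass) and l = 1 (no subtracted term) as well.\<close>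
  have Y_mean: "(if pmf P l = 0 then 0 else \<integral>\<omega>. Y l \<omega> \<partial>?R l) = s l - s (l - 1)" for l
  proof (cases "l \<le> 1")
    case True
    then have "l = 0 \<or> l = 1" by linarith
    then show ?thesis by (auto simp: P0 s_def Y_def)
  next
    case False
    \<comment> \<open>The subtracted term is computed under \<open>l\<close> runs but has the mean
      it has under \<open>l - 1\<close> runs, so consecutive increments cancel in
      expectation.\<close>
    have "(\<integral>\<omega>. G (l - 1) \<omega> \<partial>?R l) = (\<integral>\<omega>. G (l - 1) \<omega> \<partial>?R (l - 1))"
      by (intro integral_runs_law_restrict kernel \<mu> G_meas G_restr) auto
    then show ?thesis
      using False G_int[of l l] G_int[of "l - 1" l] by (simp add: P0 s_def Y_def)
  qed
  have partial: "(\<Sum>l<Suc n. s l - s (l - 1)) = s n" for n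
    by (induction n) (simp_all add: s_def)
  have "(\<lambda>n. s n - H) \<longlonglongrightarrow> 0"
  proof (rule Lim_null_comparison)
    have "norm (s n - H) \<le> sqrt (a / 2 ^ n)" if "1 \<le> n" for n
      using G_dev[OF that order_refl] that by (intro real_le_rsqrt) (simp add: s_def)
    then show "\<forall>\<^sub>F n in sequentially. norm (s n - H) \<le> sqrt (a / 2 ^ n)"
      by (intro eventually_mono[OF eventually_ge_at_top[of "1::nat"]])
    have "(\<lambda>n. a * (1 / 2) ^ n) \<longlonglongrightarrow> 0"
      by (intro tendsto_mult_right_zero LIMSEQ_power_zero) simp
    moreover have "(\<lambda>n. a * (1 / 2) ^ n) = (\<lambda>n. a / 2 ^ n)"
      by (simp add: power_one_over)
    ultimately show "(\<lambda>n. sqrt (a / 2 ^ n)) \<longlonglongrightarrow> 0"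
      using tendsto_real_sqrt[of "\<lambda>n. a / 2 ^ n" 0] by simp
  qed
  then have "s \<longlonglongrightarrow> H" by (simp add: LIM_zero_iff)
  then have sums: "(\<lambda>l. if pmf P l = 0 then 0 else \<integral>\<omega>. Y l \<omega> \<partial>?R l) sums H"
    unfolding Y_mean sums_def by (subst filterlim_sequentially_Suc[symmetric]) (simp only: partial)
  have summable: "summable (\<lambda>l. d / 2 ^ l / pmf P l)"
  proof (rule summable_comparison_test_ev)
    show "summable (\<lambda>l. d / c * (2 powr (\<beta> - 1)) ^ l)"
      using \<beta> by (intro summable_mult summable_geometric) (simp add: powr_less_one)
    \<comment> \<open>The increment bound over the mass of its level is geometric with ratio
      2^(\<beta> - 1), which is below 1 exactly when \<beta> < 1.\<close>
    have "norm (d / 2 ^ l / pmf P l) \<le> d / c * (2 powr (\<beta> - 1)) ^ l" if "1 \<le> l" for l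
    proof -
      have "(2 powr (\<beta> - 1)) ^ l = (2::real) powr (\<beta> * real l - real l)"
        by (simp add: powr_realpow[symmetric] powr_powr algebra_simps)
      also have "\<dots> = 2 powr (\<beta> * real l) / 2 ^ l"
        by (simp add: powr_diff powr_realpow)
      finally have "d / 2 ^ l / pmf P l = d / c * (2 powr (\<beta> - 1)) ^ l"
        using that by (simp add: P powr_minus divide_simps)
      moreover have "0 \<le> d / 2 ^ l / pmf P l" using a0 by (simp add: d_def)
      ultimately show ?thesis by simp
    qed
    then show "\<forall>\<^sub>F l in sequentially. norm (d / 2 ^ l / pmf P l) \<le> d / c * (2 powr (\<beta> - 1)) ^ l"
      by (intro eventually_mono[OF eventually_ge_at_top[of "1::nat"]])
  qed
  note * = randomized_sum_estimator[of ?R Y P "\<lambda>l. d / 2 ^ l" H, folded Q_def]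
  have d0: "0 \<le> d / 2 ^ l" for l using a0 by (simp add: d_def)
  have m: "integrable (?R l) (\<lambda>\<omega>. (norm (Y l \<omega>))\<^sup>2)" "(\<integral>\<omega>. (norm (Y l \<omega>))\<^sup>2 \<partial>?R l) \<le> d / 2 ^ l"
    if "pmf P l \<noteq> 0" for l
    using Y_moment[of l] that by (auto simp: P0)
  show "integrable Q (\<lambda>h. h)" "(\<integral>h. h \<partial>Q) = H" "(\<integral>\<^sup>+h. ennreal ((norm h)\<^sup>2) \<partial>Q) < \<infinity>"
    by (rule *[OF R Y_meas m d0 summable sums]; assumption)+
qed

end

section \<open>From the componentwise hypotheses to the estimator at a fixed argument\<close>

lemma norm_vec_le_sum:
  fixes x :: "'b::real_normed_vector ^ 'n::finite"
  shows "norm x \<le> (\<Sum>i\<in>UNIV. norm (x $ i))"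
  unfolding norm_vec_def by (rule L2_set_le_sum) simp

theorem proposition2p1:
  fixes Z :: "'z::euclidean_space set"
    and dX :: "'x measure"
    and \<Xi> :: "(real^'k::finite) set"
    and g :: "'z \<Rightarrow> 'x \<Rightarrow> real^'k \<Rightarrow> real^'k"
    and Dg :: "'z \<Rightarrow> 'x \<Rightarrow> real^'k \<Rightarrow> real^'k^'k"
    and f :: "'z \<Rightarrow> real^'k \<Rightarrow> real"
    and Df :: "'z \<Rightarrow> real^'k \<Rightarrow> real^'k"
    and \<nu> \<eta> :: "'z \<Rightarrow> 'x \<Rightarrow> real"
    and M :: "'z \<Rightarrow> 'x \<Rightarrow> 'x measure"
    and \<kappa> :: "'x measure"
    and \<epsilon> C \<beta> :: real
    and PL :: "nat pmf"
  assumes Z_meas: "Z \<in> sets borel"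
    and g_meas: "(\<lambda>(z, x, \<xi>). g z x \<xi>) \<in>
        borel_measurable (restrict_space borel Z \<Otimes>\<^sub>M dX \<Otimes>\<^sub>M restrict_space borel \<Xi>)"
    and Dg_meas: "(\<lambda>(z, x, \<xi>). Dg z x \<xi>) \<in>
        borel_measurable (restrict_space borel Z \<Otimes>\<^sub>M dX \<Otimes>\<^sub>M restrict_space borel \<Xi>)"
    and f_meas: "(\<lambda>(z, u). f z u) \<in> borel_measurable (restrict_space borel Z \<Otimes>\<^sub>M borel)"
    and Df_meas: "(\<lambda>(z, u). Df z u) \<in> borel_measurable (restrict_space borel Z \<Otimes>\<^sub>M borel)"
    and g_deriv: "\<And>z x \<xi>. z \<in> Z \<Longrightarrow> x \<in> space dX \<Longrightarrow> \<xi> \<in> \<Xi> \<Longrightarrow>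
        (g z x has_derivative (\<lambda>h. Dg z x \<xi> *v h)) (at \<xi> within \<Xi>)"
    and f_grad: "\<And>z u. z \<in> Z \<Longrightarrow> GDERIV (f z) u :> Df z u"
    and \<nu>_meas: "\<And>z. z \<in> Z \<Longrightarrow> \<nu> z \<in> borel_measurable dX"
    and \<nu>_nonneg: "\<And>z x. z \<in> Z \<Longrightarrow> x \<in> space dX \<Longrightarrow> 0 \<le> \<nu> z x"
    and \<nu>_prob: "\<And>z. z \<in> Z \<Longrightarrow> prob_space (density dX (\<nu> z))"
    and \<eta>_meas: "\<And>z. z \<in> Z \<Longrightarrow> \<eta> z \<in> borel_measurable dX"
    and \<eta>_pos: "\<And>z x. z \<in> Z \<Longrightarrow> x \<in> space dX \<Longrightarrow> 0 < \<eta> z x"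
    and \<eta>_prob: "\<And>z. z \<in> Z \<Longrightarrow> prob_space (density dX (\<eta> z))"
    and M_kernel: "\<And>z. z \<in> Z \<Longrightarrow> M z \<in> measurable dX (prob_algebra dX)"
    and M_stationary: "\<And>z. z \<in> Z \<Longrightarrow> stationary_measure (M z) (density dX (\<nu> z))"
    and M_ergodic: "\<And>z. z \<in> Z \<Longrightarrow> ergodic_kernel dX (M z) (density dX (\<nu> z))"
    and \<epsilon>: "\<epsilon> \<in> {0<..<1}"
    and \<kappa>: "prob_space \<kappa>" "sets \<kappa> = sets dX"
    and minorization: "\<And>z x A. z \<in> Z \<Longrightarrow> x \<in> space dX \<Longrightarrow> A \<in> sets dX \<Longrightarrow>
        \<epsilon> * measure \<kappa> A \<le> measure (M z x) A"
    and g_bdd: "\<And>i. bdd_above ((\<lambda>(z, x, \<xi>). \<bar>g z x \<xi> $ i\<bar>) ` (Z \<times> space dX \<times> \<Xi>))"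
    and Df_bdd: "\<And>i. bdd_above ((\<lambda>(z, u). \<bar>Df z u $ i\<bar>) ` (Z \<times> UNIV))"
    and Dg_bdd: "\<And>i j. bdd_above ((\<lambda>(z, x, \<xi>). \<bar>Dg z x \<xi> $ i $ j\<bar>) ` (Z \<times> space dX \<times> \<Xi>))"
    and Df_lipschitz: "\<And>i z z' u u'. z \<in> Z \<Longrightarrow> z' \<in> Z \<Longrightarrow>
        \<bar>Df z u $ i - Df z u' $ i\<bar> \<le> C * (norm (z - z') + norm (u - u'))"
    and \<beta>: "\<beta> \<in> {0<..<1}"
    and PL: "\<exists>c. \<forall>l. pmf PL l = (if l = 0 then 0 else c * 2 powr (- \<beta> * real l))"
  shows "\<forall>z\<in>Z. \<forall>\<xi>\<in>\<Xi>.
      integrable (H_hat_law dX \<eta> M g Dg Df PL z \<xi>) (\<lambda>h. h)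
    \<and> (\<integral>h. h \<partial>H_hat_law dX \<eta> M g Dg Df PL z \<xi>) = H_target dX \<nu> g Dg Df z \<xi>
    \<and> (\<forall>i. (\<integral>\<^sup>+h. ennreal ((h $ i)\<^sup>2) \<partial>H_hat_law dX \<eta> M g Dg Df PL z \<xi>) < \<infinity>)"
proof (intro ballI)
  fix z \<xi> assume z: "z \<in> Z" and \<xi>: "\<xi> \<in> \<Xi>"
  let ?u = "\<lambda>x. g z x \<xi>" and ?A = "\<lambda>x. Dg z x \<xi>"
  let ?\<mu> = "density dX (\<eta> z)" and ?\<pi> = "density dX (\<nu> z)"
  interpret stationary_minorized_kernel dX "M z" \<kappa> \<epsilon> ?\<pi>
  proof (intro stationary_minorized_kernel.intro minorized_kernel.intro
      stationary_minorized_kernel_axioms.intro)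
    show "0 < \<epsilon>" "\<epsilon> < 1" using \<epsilon> by simp_all
  qed (rule M_kernel[OF z] \<kappa> minorization[OF z] \<nu>_prob[OF z] M_stationary[OF z] sets_density; assumption?)+
  have \<mu>: "?\<mu> \<in> space (prob_algebra dX)"
    using \<eta>_prob[OF z] by (simp add: space_prob_algebra)
  \<comment> \<open>Embedding \<open>x\<close> at fixed \<open>z\<close> and \<xi> turns joint
    measurability into measurability of the sections.\<close>
  have sec: "(\<lambda>x. (z, x, \<xi>)) \<in> dX \<rightarrow>\<^sub>M restrict_space borel Z \<Otimes>\<^sub>M dX \<Otimes>\<^sub>M restrict_space borel \<Xi>"
    using z \<xi> by (intro measurable_Pair measurable_const measurable_ident) (auto simp: space_restrict_space)
  have u_meas: "?u \<in> borel_measurable dX" and A_meas: "?A \<in> borel_measurable dX"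
    using measurable_compose[OF sec g_meas] measurable_compose[OF sec Dg_meas] by simp_all
  have sec': "(\<lambda>u. (z, u)) \<in> borel \<rightarrow>\<^sub>M restrict_space borel Z \<Otimes>\<^sub>M borel"
    using z by (intro measurable_Pair measurable_const measurable_ident) (auto simp: space_restrict_space)
  have df_meas: "Df z \<in> borel_measurable borel"
    using measurable_compose[OF sec' Df_meas] by simp
  have "\<exists>b. \<forall>x\<in>space dX. \<bar>g z x \<xi> $ i\<bar> \<le> b" for i
  proof -
    obtain b where b: "\<And>p. p \<in> Z \<times> space dX \<times> \<Xi> \<Longrightarrow> (\<lambda>(z, x, \<xi>). \<bar>g z x \<xi> $ i\<bar>) p \<le> b"
      using g_bdd[of i] unfolding bdd_above_def by blast
    show ?thesis using b[of "(z, _, \<xi>)"] z \<xi> by (intro exI[of _ b]) simp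
  qed
  then obtain bg where bg: "\<And>i x. x \<in> space dX \<Longrightarrow> \<bar>g z x \<xi> $ i\<bar> \<le> bg i" by metis
  have "\<exists>b. \<forall>x\<in>space dX. \<bar>Dg z x \<xi> $ i $ j\<bar> \<le> b" for i j
  proof -
    obtain b where b: "\<And>p. p \<in> Z \<times> space dX \<times> \<Xi> \<Longrightarrow> (\<lambda>(z, x, \<xi>). \<bar>Dg z x \<xi> $ i $ j\<bar>) p \<le> b"
      using Dg_bdd[of i j] unfolding bdd_above_def by blast
    show ?thesis using b[of "(z, _, \<xi>)"] z \<xi> by (intro exI[of _ b]) simp
  qed
  then obtain bD where bD: "\<And>i j x. x \<in> space dX \<Longrightarrow> \<bar>Dg z x \<xi> $ i $ j\<bar> \<le> bD i j" by metis
  have "\<exists>b. \<forall>u. \<bar>Df z u $ i\<bar> \<le> b" for i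
  proof -
    obtain b where b: "\<And>p. p \<in> Z \<times> UNIV \<Longrightarrow> (\<lambda>(z, u). \<bar>Df z u $ i\<bar>) p \<le> b"
      using Df_bdd[of i] unfolding bdd_above_def by blast
    show ?thesis using b[of "(z, _)"] z by (intro exI[of _ b]) simp
  qed
  then obtain bf where bf: "\<And>i u. \<bar>Df z u $ i\<bar> \<le> bf i" by metis
  have u_le: "norm (?u x) \<le> (\<Sum>i\<in>UNIV. bg i)" if "x \<in> space dX" for x
    using bg[OF that] by (intro order_trans[OF norm_vec_le_sum sum_mono]) simp
  have A_le: "norm (?A x) \<le> (\<Sum>i\<in>UNIV. \<Sum>j\<in>UNIV. bD i j)" if "x \<in> space dX" for x
    using bD[OF that] by (intro order_trans[OF norm_vec_le_sum sum_mono]) simp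
  have df_le: "norm (Df z v) \<le> (\<Sum>i\<in>UNIV. bf i)" for v
    using bf by (intro order_trans[OF norm_vec_le_sum sum_mono]) simp
  have df_lip: "norm (Df z v - Df z v') \<le> (real CARD('k) * C) * norm (v - v')" for v v'
  proof -
    \<comment> \<open>The Lipschitz hypothesis is taken with both first arguments equal to
      \<open>z\<close>, so its first norm vanishes; summing over components costs the factor
      CARD('k).\<close>
    have "norm (Df z v - Df z v') \<le> (\<Sum>i\<in>(UNIV :: 'k set). C * norm (v - v'))"
      using Df_lipschitz[OF z z, where u=v and u'=v']
      by (intro order_trans[OF norm_vec_le_sum sum_mono]) simp
    then show ?thesis by simp
  qed
  obtain c where c: "\<And>l. pmf PL l = (if l = 0 then 0 else c * 2 powr (- \<beta> * real l))"
    using PL by blast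
  have \<beta>1: "\<beta> < 1" using \<beta> by simp
  let ?G = "\<lambda>l \<omega>. plug_in (Df z) (pooled_mean l \<omega> ?A) (pooled_mean l \<omega> ?u)"
  \<comment> \<open>Both branches of the estimator take the form of weighted increments of pooled
    plug-in values, the case l = 1 through \<open>pooled_mean_1\<close>.\<close>
  have H_hat: "H_hat g Dg Df PL z \<xi> l =
      (\<lambda>\<omega>. (1 / pmf PL l) *\<^sub>R (if l = 1 then ?G 1 \<omega> else ?G l \<omega> - ?G (l - 1) \<omega>))" for l
    by (simp only: fun_eq_iff H_hat_def pooled_mean_1) simp
  note * = telescoping_estimator[OF u_meas u_le A_meas A_le df_meas df_le df_lip \<mu> c \<beta>1, folded H_hat]
  note est = *[folded H_hat_law_def H_target_def]
  have "(\<integral>\<^sup>+h. ennreal ((h $ i)\<^sup>2) \<partial>H_hat_law dX \<eta> M g Dg Df PL z \<xi>) < \<infinity>" for i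
  proof (rule order.strict_trans1[OF nn_integral_mono est(3)])
    fix h :: "real^'k"
    have "(h $ i)\<^sup>2 \<le> (norm h)\<^sup>2"
      using power_mono[OF component_le_norm_cart[of h i], of 2] by simp
    then show "ennreal ((h $ i)\<^sup>2) \<le> ennreal ((norm h)\<^sup>2)" by (rule ennreal_leI)
  qed
  with est(1,2) show "integrable (H_hat_law dX \<eta> M g Dg Df PL z \<xi>) (\<lambda>h. h)
    \<and> (\<integral>h. h \<partial>H_hat_law dX \<eta> M g Dg Df PL z \<xi>) = H_target dX \<nu> g Dg Df z \<xi>
    \<and> (\<forall>i. (\<integral>\<^sup>+h. ennreal ((h $ i)\<^sup>2) \<partial>H_hat_law dX \<eta> M g Dg Df PL z \<xi>) < \<infinity>)"
    by blast
qed

end
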